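(* Let $p\le q$ be positive integers with $\gcd(p,q)=1$, let $k\ge2$, and set $m_{(0,0)}=0$. Then \[ m_{(kq,kp)}=m^{\circ}_{\frac pq}\,m_{((k-1)q,(k-1)p)}-m_{((k-2)q,(k-2)p)}. \]
   Context: Lattice. Use the lattice of unit segments on the lines $y=c$, $x=c$, $y=-x+c$ ($c\in\mathbb Z$). Sign sequence of an oriented path. Let $\delta$ be an oriented path from one lattice point to another, transverse to the lattice segments it crosses, crossing $\sigma_1,\ldots,\sigma_N$ in order at points $s_i$. Its sign sequence is $(f_0,\ldots,f_{2N})$, defined as follows. - $f_0=-$ and $f_{2N}=+$. - $f_{2i-1}=-$ if $s_i$ is closer to the endpoint of $\sigma_i$ to the right of $\delta$, and $+$ if closer to the left endpoint (either sign if at the midpoint). - $f_{2i}=-$ if the common endpoint of $\sigma_i,\sigma_{i+1}$ lies to the right of $\delta$, and $+$ otherwise. Its continued fraction is $[a_1,\ldots,a_n]$, where the $a_i$ are the lengths of the maximal blocks of consecutive equal signs. Here $[a_1,\ldots,a_n]=a_1+1/(a_2+1/(\cdots+1/a_n))$, and $\mathcal N[\cdots]$ is its numerator in lowest terms. Definition of $m_{(kq,kp)}$. For coprime $p\le q$ and $k\ge1$, let $\delta$ be the segment from $(0,0)$ to $(kq,kp)$, deformed near each lattice point $(iq,ip)$, $1\le i\le k-1$, to pass around it by a small half-circle on its left. Define $m_{(kq,kp)}=\mathcal N$ of the continued fraction of the sign sequence of $\delta$. For $k=1$ this is the generalized Markov number $m_{\frac pq}$. Generalized Markov numbers. Start from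 the three positions with labels $\tfrac01,\tfrac10,\tfrac{-1}1$, each carrying the number $1$. Mutating a position with label $\tfrac ef$ and number $z$ (the others having labels $\tfrac ab,\tfrac cd$ and numbers $x,y$) replaces the label by $\tfrac{a+c}{b+d}$ (or $\tfrac{c-a}{d-b}$ if $\tfrac ef=\tfrac{a+c}{b+d}$) and $z$ by $(x^2+xy+y^2)/z$. Use sequences starting at $\tfrac{-1}1$, then $\tfrac10$, with no immediate repetition; $m_{\frac pq}$ is the number carried by label $\tfrac pq$. Definition of $m^\circ_{\frac pq}$. Let $\mathcal O_3$ be the once-punctured sphere with three orbifold points of order 3, with initial triangulation $T_0$ of pending arcs $\tau_{\frac01},\tau_{\frac10},\tau_{\frac{-1}1}$, represented by lattice segments of slope $0,\infty,-1$. Move the endpoints of the segment $(0,0)\to(q,p)$ to $(\epsilon,\epsilon)$ and $(q+\epsilon,p+\epsilon)$, nudge it to avoid $(q,p)$, and identify the endpoints. This gives a simple closed curve on $\mathcal O_3$. $m^\circ_{\frac pq}$ is the number of good matchings of its band graph with respect to $T_0$, i.e. the number of perfect matchings of the underlying snake graph containing at least one of the two glued edges. It does not depend on the nudging direction.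
   Formalization: For k ≥ 2 the sign at a midpoint crossing is fixed to be + (it is free only for k = 1), because the numerator depends on this choice: for p = q = 1, k = 2 the choices ++, −+, +−, −− give 51, 54, 54, 57, and only 51 satisfies the formula. *)

theory Defs
  imports "HOL-Analysis.Analysis"
begin

section \<open>Lattice segments and the sides of a path\<close>

text \<open>The plane is \<^typ>\<open>complex\<close>; a unit segment of the lattice is given by its endpoints. The three
  directions are those of the lines \<open>y = c\<close>, \<open>x = c\<close>, \<open>y = -x + c\<close>.\<close>

definition lattice_segments :: "(complex \<times> complex) set" where
  "lattice_segments =
     {(A, B). Re A \<in> \<int> \<and> Im A \<in> \<int> \<and> B - A \<in> {1, \<i>, 1 - \<i>}}"

definition crossing_times :: "(real \<Rightarrow> complex) \<Rightarrow> real set \<Rightarrow> real list" where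
  "crossing_times \<gamma> T =
     sorted_list_of_set {t \<in> T. \<exists>(A, B) \<in> lattice_segments. \<gamma> t \<in> open_segment A B}"

definition ends_at :: "(real \<Rightarrow> complex) \<Rightarrow> real \<Rightarrow> complex set" where
  "ends_at \<gamma> t = (THE E. \<exists>A B. E = {A, B} \<and> (A, B) \<in> lattice_segments \<and> \<gamma> t \<in> open_segment A B)"

text \<open>Sides are only ever tested for endpoints of the segment that \<open>\<gamma>\<close> crosses at time \<open>t\<close>, so the
  tangent at the crossing decides them.\<close>

definition left_of :: "(real \<Rightarrow> complex) \<Rightarrow> real \<Rightarrow> complex \<Rightarrow> bool" where
  "left_of \<gamma> t P \<longleftrightarrow> 0 < Im (cnj (vector_derivative \<gamma> (at t)) * (P - \<gamma> t))"

definition right_of :: "(real \<Rightarrow> complex) \<Rightarrow> real \<Rightarrow> complex \<Rightarrow> bool" where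
  "right_of \<gamma> t P \<longleftrightarrow> Im (cnj (vector_derivative \<gamma> (at t)) * (P - \<gamma> t)) < 0"


section \<open>Sign sequences\<close>

datatype pm = Minus | Plus

text \<open>The argument \<open>s\<close> is the sign to be used when \<open>\<gamma>\<close> crosses at the midpoint.\<close>

definition crossing_sign :: "pm \<Rightarrow> (real \<Rightarrow> complex) \<Rightarrow> real \<Rightarrow> pm" where
  "crossing_sign s \<gamma> t =
     (let L = (THE P. P \<in> ends_at \<gamma> t \<and> left_of \<gamma> t P);
          R = (THE P. P \<in> ends_at \<gamma> t \<and> right_of \<gamma> t P)
      in if dist (\<gamma> t) R < dist (\<gamma> t) L then Minus
         else if dist (\<gamma> t) L < dist (\<gamma> t) R then Plus
         else s)"

definition corner_sign :: "(real \<Rightarrow> complex) \<Rightarrow> real \<Rightarrow> real \<Rightarrow> pm" where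
  "corner_sign \<gamma> t t' =
     (if \<exists>P \<in> ends_at \<gamma> t \<inter> ends_at \<gamma> t'. right_of \<gamma> t P then Minus else Plus)"

fun inner_signs :: "pm \<Rightarrow> (real \<Rightarrow> complex) \<Rightarrow> real list \<Rightarrow> pm list" where
  "inner_signs s \<gamma> [] = []"
| "inner_signs s \<gamma> [t] = [crossing_sign s \<gamma> t]"
| "inner_signs s \<gamma> (t # t' # ts) =
     crossing_sign s \<gamma> t # corner_sign \<gamma> t t' # inner_signs s \<gamma> (t' # ts)"

definition sign_sequence :: "pm \<Rightarrow> (real \<Rightarrow> complex) \<Rightarrow> real \<Rightarrow> real \<Rightarrow> pm list" where
  "sign_sequence s \<gamma> a b = Minus # inner_signs s \<gamma> (crossing_times \<gamma> {a<..<b}) @ [Plus]"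

function (sequential) block_lengths :: "'a list \<Rightarrow> nat list" where
  "block_lengths [] = []"
| "block_lengths (x # xs) =
     Suc (length (takeWhile (\<lambda>y. y = x) xs)) # block_lengths (dropWhile (\<lambda>y. y = x) xs)"
  by pat_completeness auto
termination
  by (relation "Wellfounded.measure length") (auto simp: le_imp_less_Suc length_dropWhile_le)

fun cont_frac :: "nat list \<Rightarrow> rat" where
  "cont_frac [] = 0"
| "cont_frac [a] = of_nat a"
| "cont_frac (a # b # as) = of_nat a + 1 / cont_frac (b # as)"

definition cf_numerator :: "nat list \<Rightarrow> int" where
  "cf_numerator as = fst (quotient_of (cont_frac as))"


section \<open>The numbers attached to \<open>(kq, kp)\<close>\<close>

text \<open>For \<open>t\<close> in \<open>[0, k]\<close> the path runs along the line through the origin, at \<open>t (q, p)\<close>, except within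
  distance \<open>r\<close> of an intermediate lattice point \<open>i (q, p)\<close>. There it follows the half-circle of
  radius \<open>r\<close> clockwise, the angle to the direction \<open>(q, p)\<close> decreasing from \<open>pi\<close> to \<open>0\<close>, and so
  leaves the lattice point on its right.\<close>

definition deformed_path :: "real \<Rightarrow> nat \<Rightarrow> nat \<Rightarrow> nat \<Rightarrow> real \<Rightarrow> complex" where
  "deformed_path r k q p t =
     (let v = Complex (of_nat q) (of_nat p); i = round t
      in if 1 \<le> i \<and> i < int k \<and> \<bar>t - of_int i\<bar> * norm v < r
         then of_int i * v
              + of_real r * sgn v * cis (pi / 2 * (1 - (t - of_int i) * norm v / r))
         else of_real t * v)"

text \<open>For \<open>k = 1\<close> there is a single midpoint crossing, at \<open>(q, p) / 2\<close>, and \<open>s\<close> is the sign chosen there.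
  For \<open>k \<ge> 2\<close> the sign at the midpoints is not immaterial: for \<open>q = p = 1\<close> and \<open>k = 2\<close> the four
  choices at the two midpoints give 51, 54, 54 and 57. The sign is then \<^const>\<open>Plus\<close>, that of
  a path pushed to its left at the midpoints, as it is at the lattice points.\<close>

definition markov_num :: "pm \<Rightarrow> real \<Rightarrow> nat \<Rightarrow> nat \<Rightarrow> nat \<Rightarrow> int" where
  "markov_num s r k q p =
     (if k = 0 then 0
      else cf_numerator (block_lengths
             (sign_sequence (if k = 1 then s else Plus) (deformed_path r k q p) 0 (of_nat k))))"


section \<open>Band graphs and good matchings\<close>

text \<open>A lattice segment represents a pending arc, with the orbifold point at its midpoint. A curve
  that crosses the segment enters and leaves the monogon cut off by the pending arc, and so crosses
  the arc twice. Unfolding the orbifold point of order 3 turns the monogon into a triangle, of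
  which the curve cuts off the corner given by the endpoint of the segment that is not separated
  from it by the midpoint, that is, by the closer endpoint. Thus a closed curve that crosses
  \<open>N\<close> lattice segments has \<open>d = 2 N\<close> crossings with \<open>T\<^sub>0\<close>. Between the \<open>j\<close>th and the next of them
  (cyclically) it passes through a triangle and cuts off a corner, on its left
  (\<open>f\<^sub>j\<close> is \<^const>\<open>Plus\<close>) or on its right (\<^const>\<open>Minus\<close>).

  The path \<open>\<gamma>\<close> below is the periodic extension of a lift of the closed curve to the plane;
  \<open>1 + hd ts\<close> is the time at which the first crossing recurs. No crossing occurs at a midpoint, so
  the sign for such crossings has no effect.\<close>

definition cyclic_signs :: "(real \<Rightarrow> complex) \<Rightarrow> pm list" where
  "cyclic_signs \<gamma> =
     (let ts = crossing_times \<gamma> {0<..<1}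
      in butlast (inner_signs Plus \<gamma> (ts @ [1 + hd ts])))"

type_synonym vertex = "nat \<times> nat"

definition south :: "vertex \<Rightarrow> vertex set" where "south c = {c, c + (1, 0)}"
definition north :: "vertex \<Rightarrow> vertex set" where "north c = {c + (0, 1), c + (1, 1)}"
definition west :: "vertex \<Rightarrow> vertex set" where "west c = {c, c + (0, 1)}"
definition east :: "vertex \<Rightarrow> vertex set" where "east c = {c + (1, 0), c + (1, 1)}"

text \<open>Tiles are numbered from \<open>0\<close> and named by their south-west vertex. Tile \<open>j\<close> consists of the two
  triangles adjacent to the \<open>j\<close>th crossed arc, which is its diagonal from north-west to south-east;
  the curve runs from south-west to north-east. Tiles alternately preserve and reverse the orientation
  of the surface. The next tile is glued along the third side of the triangle in between. In a tile
  that preserves the orientation this is the east side if the corner cut off is on the left, and the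
  north side otherwise; in a tile that reverses it the roles are exchanged.\<close>

definition exits_east :: "pm list \<Rightarrow> nat \<Rightarrow> bool" where
  "exits_east fs j \<longleftrightarrow> (fs ! j = Plus \<longleftrightarrow> even j)"

fun tile :: "pm list \<Rightarrow> nat \<Rightarrow> vertex" where
  "tile fs 0 = (0, 0)"
| "tile fs (Suc j) = tile fs j + (if exits_east fs j then (1, 0) else (0, 1))"

definition snake_edges :: "pm list \<Rightarrow> vertex set set" where
  "snake_edges fs =
     (\<Union>j < length fs. {south (tile fs j), north (tile fs j), west (tile fs j), east (tile fs j)})"

definition perfect_matching :: "'v set set \<Rightarrow> 'v set set \<Rightarrow> bool" where
  "perfect_matching E M \<longleftrightarrow> M \<subseteq> E \<and> (\<forall>v \<in> \<Union>E. \<exists>!e. e \<in> M \<and> v \<in> e)"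

text \<open>The two edges of the snake graph that are glued in the band graph represent the third side of the
  triangle that the curve passes through between the last and the first crossing.\<close>

definition first_glued_edge :: "pm list \<Rightarrow> vertex set" where
  "first_glued_edge fs = (if last fs = Plus then south (tile fs 0) else west (tile fs 0))"

definition last_glued_edge :: "pm list \<Rightarrow> vertex set" where
  "last_glued_edge fs =
     (let d = length fs in
      if exits_east fs (d - 1) then east (tile fs (d - 1)) else north (tile fs (d - 1)))"

definition good_matchings :: "pm list \<Rightarrow> vertex set set set" where
  "good_matchings fs =
     {M. perfect_matching (snake_edges fs) M \<and> (first_glued_edge fs \<in> M \<or> last_glued_edge fs \<in> M)}"


section \<open>The closed curve of slope \<open>p/q\<close>\<close>

text \<open>The initial point is \<open>(\<epsilon>, \<epsilon>)\<close>, nudged to the left of the direction \<open>(q, p)\<close> if \<open>\<eta> > 0\<close> and to the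
  right if \<open>\<eta> < 0\<close>. The whole segment is translated, since a curve that passes \<open>(q, p)\<close> and
  the orbifold point \<open>(q, p) / 2\<close> on different sides need not be simple on the orbifold.\<close>

definition nudged_start :: "nat \<Rightarrow> nat \<Rightarrow> real \<Rightarrow> real \<Rightarrow> complex" where
  "nudged_start q p \<epsilon> \<eta> = Complex \<epsilon> \<epsilon> + of_real \<eta> * \<i> * Complex (of_nat q) (of_nat p)"

text \<open>The initial point stays in the lattice triangle that contains \<open>(\<epsilon>, \<epsilon>)\<close>. The function
  \<open>q y - p x\<close> is constant on the curve, takes integer values at lattice points and multiples of \<open>1/2\<close>
  at midpoints, so the last condition says that the curve avoids both and that none of them lies
  strictly between the curve and the line through \<open>(0, 0)\<close> and \<open>(q, p)\<close>.\<close>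

definition small_nudge :: "nat \<Rightarrow> nat \<Rightarrow> real \<Rightarrow> real \<Rightarrow> bool" where
  "small_nudge q p \<epsilon> \<eta> \<longleftrightarrow>
     (let z = nudged_start q p \<epsilon> \<eta>; h = of_nat q * Im z - of_nat p * Re z
      in 0 < \<epsilon> \<and> 0 < Re z \<and> 0 < Im z \<and> Re z + Im z < 1 \<and> 0 < \<bar>h\<bar> \<and> \<bar>h\<bar> < 1 / 2)"

definition closed_curve :: "nat \<Rightarrow> nat \<Rightarrow> real \<Rightarrow> real \<Rightarrow> real \<Rightarrow> complex" where
  "closed_curve q p \<epsilon> \<eta> t = nudged_start q p \<epsilon> \<eta> + of_real t * Complex (of_nat q) (of_nat p)"

definition markov_circ :: "nat \<Rightarrow> nat \<Rightarrow> real \<Rightarrow> real \<Rightarrow> nat" where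
  "markov_circ q p \<epsilon> \<eta> = card (good_matchings (cyclic_signs (closed_curve q p \<epsilon> \<eta>)))"

end

theory Submission
  imports Defs
begin

text \<open>Send the signs \<open>Minus\<close> and \<open>Plus\<close> to the two elementary unitriangular matrices. The numerator
  of a continued fraction given by a sign sequence \<open>-, f\<^sub>1, \<dots>, f\<^sub>m, +\<close> is the sum of the entries of the
  product of the matrices of the \<open>f\<^sub>i\<close>, and the number of good matchings of a band graph is the trace of
  such a product: adding a tile to a snake graph multiplies the vector that counts the matchings with
  and without the exit edge by one of the two matrices.

  Let \<open>A\<close> be the product for the straight part of the path from \<open>(0, 0)\<close> to \<open>(q, p)\<close>. A half-circle always
  contributes the signs \<open>+ - - - - - +\<close>, with product \<open>C\<close>, and \<open>C (1, -1) = (1, 1)\<close>. So the number of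
  \<open>(kq, kp)\<close> is the sum of the coordinates of \<open>(A C)\<^sup>k (1, -1)\<close>, for \<open>k = 0\<close> too. The closed curve, nudged
  to the left, has the cyclic signs of \<open>A C\<close>, and the recursion is the theorem of Cayley and Hamilton
  for \<open>A C\<close>, a matrix of determinant \<open>1\<close>. The point reflection of the path at its midpoint reverses the
  signs and exchanges left and right, which transposes \<open>A\<close>; hence neither the sign at the midpoint for
  \<open>k = 1\<close> nor the direction of the nudge matters.\<close>

section \<open>Words of signs and continued fractions\<close>

text \<open>The vector (1, -1) comes from the fan of segments at a lattice point: the matrix of
  \<open>Plus\<close> sends it to (1, 0), which every power of the matrix of \<open>Minus\<close>
  fixes, and then to (1, 1). The identity thus holds for any exponent; 5 is three crossings and the
  two corners between them. The obstacle is geometric: the deformed path and the nudged curve meet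
  the lattice at different times, so their signs cannot be compared time by time. Both are reduced
  to the segment from 0 to \<open>v\<close>. Signs are rewritten in terms of the endpoint sets of
  the crossed segments and of \<open>height v P\<close>, that is q y - p x, which is constant along
  the direction of \<open>v\<close>, positive on the left and an integer at lattice points. The
  estimates for the nudged line come from this integrality: a line of height below 1/2 in absolute
  value crosses the same segments in the same order, and only the signs at midpoints feel on which
  side it lies. Near a lattice point, where this argument stops, the two curves are computed
  separately and give the same fan.\<close>

fun flip_sign :: "pm \<Rightarrow> pm" where
  "flip_sign Minus = Plus"
| "flip_sign Plus = Minus"

definition sign_matrix :: "pm \<Rightarrow> int^2^2" where
  "sign_matrix f =
     (case f of Minus \<Rightarrow> vector [vector [1, 1], vector [0, 1]]
              | Plus \<Rightarrow> vector [vector [1, 0], vector [1, 1]])"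

definition word_matrix :: "pm list \<Rightarrow> int^2^2" where
  "word_matrix fs = foldr (\<lambda>f M. sign_matrix f ** M) fs (mat 1)"

lemma word_matrix_simps [simp]:
  "word_matrix [] = mat 1"
  "word_matrix (f # fs) = sign_matrix f ** word_matrix fs"
  by (simp_all add: word_matrix_def)

lemma word_matrix_append: "word_matrix (fs @ gs) = word_matrix fs ** word_matrix gs"
  by (induction fs) (simp_all add: matrix_mul_assoc)

lemma sign_matrix_nth [simp]:
  "sign_matrix f $ 1 $ 1 = 1" "sign_matrix f $ 2 $ 2 = 1"
  "sign_matrix f $ 1 $ 2 = (if f = Minus then 1 else 0)"
  "sign_matrix f $ 2 $ 1 = (if f = Plus then 1 else 0)"
  by (cases f; simp add: sign_matrix_def)+

lemma transpose_sign_matrix: "transpose (sign_matrix f) = sign_matrix (flip_sign f)"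
  by (cases f) (simp_all add: vec_eq_iff forall_2 transpose_def)

lemma transpose_word_matrix:
  "transpose (word_matrix fs) = word_matrix (rev (map flip_sign fs))"
  by (induction fs)
    (simp_all add: matrix_transpose_mul transpose_sign_matrix word_matrix_append)

lemma det_sign_matrix: "det (sign_matrix f) = 1"
  by (simp add: det_2)

lemma det_word_matrix: "det (word_matrix fs) = 1"
  by (induction fs) (simp_all add: det_mul det_sign_matrix)

lemma cayley_hamilton_2:
  fixes A :: "'a::comm_ring_1 ^ 2 ^ 2"
  shows "A *v (A *v x) = trace A *s (A *v x) - det A *s x"
  by (simp add: vec_eq_iff forall_2 matrix_vector_mult_def sum_2 det_2 trace_def algebra_simps)

text \<open>The signs between two consecutive copies of the straight part, where the path passes the
  lattice point on its left (\<^const>\<open>Plus\<close>) or on its right (\<^const>\<open>Minus\<close>).\<close>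

definition turn_signs :: "pm \<Rightarrow> pm list" where
  "turn_signs s = s # replicate 5 (flip_sign s) @ [s]"

lemma turn_signs_flip: "turn_signs (flip_sign s) = rev (map flip_sign (turn_signs s))"
  by (cases s) (simp_all add: turn_signs_def numeral_eq_Suc)

lemma word_matrix_turn_signs:
  "word_matrix (turn_signs Plus) *v vector [1, -1] = vector [1, 1]"
  by (simp add: turn_signs_def numeral_eq_Suc vec_eq_iff forall_2 matrix_vector_mult_def
      matrix_matrix_mult_def sum_2 mat_def)

section \<open>Continued fractions as entries of matrix products\<close>

lemma block_lengths_Cons_same:
  "block_lengths (x # x # xs) = Suc (hd (block_lengths (x # xs))) # tl (block_lengths (x # xs))"
  by simp

lemma block_lengths_Cons_diff:
  "x \<noteq> y \<Longrightarrow> block_lengths (x # y # xs) = 1 # block_lengths (y # xs)"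
  by simp

lemma cont_frac_Suc: "as \<noteq> [] \<Longrightarrow> cont_frac (Suc (hd as) # tl as) = 1 + cont_frac as"
  by (cases as rule: cont_frac.cases) auto

lemma cont_frac_1_Cons: "as \<noteq> [] \<Longrightarrow> cont_frac (1 # as) = 1 + 1 / cont_frac as"
  by (cases as) auto

lemma block_lengths_neq_Nil: "xs \<noteq> [] \<Longrightarrow> block_lengths xs \<noteq> []"
  by (cases xs) auto

text \<open>Prefixing a sign turns the value x into 1 + x if it repeats the first sign and into 1 +
  1/x if it does not. On the first column (a, c) the matrix of \<open>Minus\<close> gives (a + c, c)
  and that of \<open>Plus\<close> gives (a, a + c). Reading the quotient upside down according to
  the first sign makes the two rules agree. The final \<open>Plus\<close> starts the column at (1,
  1), hence positivity.\<close>

lemma cont_frac_block_lengths: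
  assumes "xs \<noteq> []" "last xs = Plus"
  defines "M \<equiv> word_matrix xs"
  shows "M $ 1 $ 1 > 0 \<and> M $ 2 $ 1 > 0 \<and>
         cont_frac (block_lengths xs) =
           (case hd xs of Minus \<Rightarrow> of_int (M $ 1 $ 1) / of_int (M $ 2 $ 1)
                        | Plus \<Rightarrow> of_int (M $ 2 $ 1) / of_int (M $ 1 $ 1))"
  using assms(1,2) unfolding M_def
proof (induction xs rule: induct_list012)
  case 1
  then show ?case by simp
next
  case (2 x)
  then show ?case by (simp add: matrix_matrix_mult_def sum_2 mat_def)
next
  case (3 x y zs)
  define N where "N = word_matrix (y # zs)"
  have IH: "N $ 1 $ 1 > 0" "N $ 2 $ 1 > 0"
    "cont_frac (block_lengths (y # zs)) =
       (case y of Minus \<Rightarrow> of_int (N $ 1 $ 1) / of_int (N $ 2 $ 1)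
                | Plus \<Rightarrow> of_int (N $ 2 $ 1) / of_int (N $ 1 $ 1))"
    using "3.IH"(2) "3.prems"(2) unfolding N_def by auto
  have M: "word_matrix (x # y # zs) = sign_matrix x ** N"
    by (simp add: N_def)
  have pos: "(of_int (N $ 1 $ 1) :: rat) > 0" "(of_int (N $ 2 $ 1) :: rat) > 0"
    using IH(1,2) by simp_all
  have ne: "block_lengths (y # zs) \<noteq> []"
    by (simp add: block_lengths_neq_Nil)
  have cf: "cont_frac (block_lengths (x # y # zs)) =
      (if x = y then 1 + cont_frac (block_lengths (y # zs))
       else 1 + 1 / cont_frac (block_lengths (y # zs)))"
    using cont_frac_Suc[OF ne] cont_frac_1_Cons[OF ne] block_lengths_Cons_diff[of x y zs]
      block_lengths_Cons_same[of y zs] by metis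
  show ?case
    unfolding M cf IH(3)
    using IH(1,2) pos by (cases x; cases y; simp add: matrix_matrix_mult_def sum_2 field_simps)
qed

lemma quotient_of_div_coprime:
  assumes "coprime a b" "b > 0"
  shows "quotient_of (of_int a / of_int b) = (a, b)"
  using assms by (simp flip: Fract_of_int_quotient add: quotient_of_Fract normalize_stable)

text \<open>The first row of the matrix of \<open>Minus\<close> and the first column of that of
  \<open>Plus\<close> are both (1, 1), so the two outer signs turn the top left entry into the sum
  over the inner product.\<close>

lemma cf_numerator_eq:
  "cf_numerator (block_lengths (Minus # fs @ [Plus])) =
     (\<Sum>i\<in>UNIV. \<Sum>j\<in>UNIV. word_matrix fs $ i $ j)"
proof -
  define M where "M = word_matrix (Minus # fs @ [Plus])"
  have pos: "M $ 2 $ 1 > 0"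
    and cf: "cont_frac (block_lengths (Minus # fs @ [Plus])) =
               of_int (M $ 1 $ 1) / of_int (M $ 2 $ 1)"
    using cont_frac_block_lengths[of "Minus # fs @ [Plus]"] by (simp_all add: M_def)
  \<comment> \<open>Determinant 1 makes the first column coprime: the fraction is already in lowest
    terms.\<close>
  have "M $ 1 $ 1 * M $ 2 $ 2 - M $ 1 $ 2 * M $ 2 $ 1 = 1"
    using det_word_matrix[of "Minus # fs @ [Plus]"] by (simp add: M_def det_2)
  then have "coprime (M $ 1 $ 1) (M $ 2 $ 1)"
    by (metis coprimeI dvd_diff dvd_mult dvd_mult2)
  then have "cf_numerator (block_lengths (Minus # fs @ [Plus])) = M $ 1 $ 1"
    unfolding cf_numerator_def cf using pos by (simp add: quotient_of_div_coprime)
  also have "M = sign_matrix Minus ** word_matrix fs ** sign_matrix Plus"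
    by (simp add: M_def word_matrix_append matrix_mul_assoc)
  finally show ?thesis
    by (simp add: matrix_matrix_mult_def sum_2)
qed

section \<open>Matchings of band graphs\<close>

lemma perfect_matching_iff:
  "perfect_matching E M \<longleftrightarrow> M \<subseteq> E \<and> \<Union>M = \<Union>E \<and> (\<forall>e\<in>M. \<forall>f\<in>M. e \<noteq> f \<longrightarrow> e \<inter> f = {})"
proof
  assume L: "perfect_matching E M"
  then have M: "M \<subseteq> E" and ex: "\<And>v. v \<in> \<Union>E \<Longrightarrow> \<exists>!e. e \<in> M \<and> v \<in> e"
    by (simp_all only: perfect_matching_def)
  have "e \<inter> f = {}" if "e \<in> M" "f \<in> M" "e \<noteq> f" for e f
  proof (rule ccontr)
    assume "e \<inter> f \<noteq> {}"
    then obtain v where "v \<in> e" "v \<in> f" by blast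
    then show False using ex[of v] M that by blast
  qed
  moreover have "\<Union>E \<subseteq> \<Union>M"
    using ex by blast
  ultimately show "M \<subseteq> E \<and> \<Union>M = \<Union>E \<and> (\<forall>e\<in>M. \<forall>f\<in>M. e \<noteq> f \<longrightarrow> e \<inter> f = {})"
    using M by (simp add: Union_mono subset_antisym)
next
  assume R: "M \<subseteq> E \<and> \<Union>M = \<Union>E \<and> (\<forall>e\<in>M. \<forall>f\<in>M. e \<noteq> f \<longrightarrow> e \<inter> f = {})"
  have "\<exists>!e. e \<in> M \<and> v \<in> e" if "v \<in> \<Union>E" for v
  proof -
    have "v \<in> \<Union>M" using R that by (simp only: R)
    then obtain e where e: "e \<in> M" "v \<in> e" by (rule UnionE)
    have u: "f = e" if f: "f \<in> M \<and> v \<in> f" for f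
    proof (rule ccontr)
      assume "f \<noteq> e"
      then have "f \<inter> e = {}" using R e(1) f by simp
      then show False using e(2) f by auto
    qed
    show ?thesis by (rule ex1I[of _ e]) (simp add: e, rule u)
  qed
  then show "perfect_matching E M"
    unfolding perfect_matching_def using conjunct1[OF R] by (intro conjI ballI)
qed

text \<open>Each new vertex lies on two edges only. Either the far edge covers both new vertices and
  the rest is a matching of \<open>E\<close>, or both side edges are used; these also cover
  \<open>v1\<close> and \<open>v2\<close>, and trading them for the edge between \<open>v1\<close>
  and \<open>v2\<close> gives back a matching of \<open>E\<close>.\<close>

lemma Collect_perfect_matching_add_square:
  assumes e: "{v1, v2} \<in> E" "v1 \<noteq> v2" and w: "w1 \<notin> \<Union>E" "w2 \<notin> \<Union>E" "w1 \<noteq> w2"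
  shows "{M. perfect_matching (E \<union> {{v1, w1}, {v2, w2}, {w1, w2}}) M} =
           insert {w1, w2} ` {M. perfect_matching E M} \<union>
           (\<lambda>M. M - {{v1, v2}} \<union> {{v1, w1}, {v2, w2}}) ` {M. perfect_matching E M \<and> {v1, v2} \<in> M}"
    (is "?L = ?R1 \<union> ?R2")
proof (intro equalityI subsetI)
  let ?E' = "E \<union> {{v1, w1}, {v2, w2}, {w1, w2}}"
  have v: "v1 \<in> \<Union>E" "v2 \<in> \<Union>E" using e by auto
  then have vw: "v1 \<noteq> w1" "v1 \<noteq> w2" "v2 \<noteq> w1" "v2 \<noteq> w2" using w by auto
  have UE': "\<Union>?E' = \<Union>E \<union> {w1, w2}" using v by auto
  fix M assume "M \<in> ?R1 \<union> ?R2"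
  then show "M \<in> ?L"
  proof
    assume "M \<in> ?R1"
    then obtain N where N: "perfect_matching E N" "M = insert {w1, w2} N" by auto
    then have "\<forall>f\<in>N. f \<inter> {w1, w2} = {}"
      using w unfolding perfect_matching_iff by blast
    then have "\<forall>e\<in>M. \<forall>f\<in>M. e \<noteq> f \<longrightarrow> e \<inter> f = {}"
      using N unfolding perfect_matching_iff by (metis inf_commute insertE)
    moreover have "M \<subseteq> ?E'" "\<Union>M = \<Union>E \<union> {w1, w2}"
      using N unfolding perfect_matching_iff by auto
    ultimately show ?thesis
      using UE' unfolding perfect_matching_iff by simp
  next
    assume "M \<in> ?R2"
    then obtain N where N: "perfect_matching E N" "{v1, v2} \<in> N"
      "M = N - {{v1, v2}} \<union> {{v1, w1}, {v2, w2}}" by auto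
    have dis: "\<forall>f\<in>N - {{v1, v2}}. f \<inter> {v1, v2, w1, w2} = {}"
    proof
      fix f assume f: "f \<in> N - {{v1, v2}}"
      then have "f \<inter> {v1, v2} = {}" using N(1,2) unfolding perfect_matching_iff by simp
      moreover have "f \<subseteq> \<Union>E" using f N(1) unfolding perfect_matching_iff by auto
      ultimately show "f \<inter> {v1, v2, w1, w2} = {}" using w by blast
    qed
    have "\<Union>E = {v1, v2} \<union> \<Union>(N - {{v1, v2}})"
      using N(1,2) unfolding perfect_matching_iff by (metis Union_insert insert_Diff)
    moreover have "{v1, v2} \<inter> \<Union>(N - {{v1, v2}}) = {}"
      using dis by auto
    ultimately have "\<Union>(N - {{v1, v2}}) = \<Union>E - {v1, v2}"
      by auto
    then have "\<Union>M = \<Union>E \<union> {w1, w2}"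
      unfolding N(3) using v by auto
    moreover have "M \<subseteq> ?E'" using N unfolding perfect_matching_iff by auto
    moreover have "\<forall>e\<in>M. \<forall>f\<in>M. e \<noteq> f \<longrightarrow> e \<inter> f = {}"
    proof -
      have dis1: "f \<inter> {v1, w1} = {}" "{v1, w1} \<inter> f = {}" "f \<inter> {v2, w2} = {}" "{v2, w2} \<inter> f = {}"
        if "f \<in> N - {{v1, v2}}" for f
        using dis that by auto
      have dis2: "{v1, w1} \<inter> {v2, w2} = {}" "{v2, w2} \<inter> {v1, w1} = {}"
        using vw e(2) w(3) by auto
      have "e \<inter> f = {}" if "e \<in> N - {{v1, v2}}" "f \<in> N - {{v1, v2}}" "e \<noteq> f" for e f
        using N(1) that unfolding perfect_matching_iff by simp
      then show ?thesis
        unfolding N(3) using dis1 dis2 by (metis Un_iff insertE singletonD)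
    qed
    ultimately show ?thesis
      using UE' unfolding perfect_matching_iff by simp
  qed
next
  let ?E' = "E \<union> {{v1, w1}, {v2, w2}, {w1, w2}}"
  have v: "v1 \<in> \<Union>E" "v2 \<in> \<Union>E" using e by auto
  then have vw: "v1 \<noteq> w1" "v1 \<noteq> w2" "v2 \<noteq> w1" "v2 \<noteq> w2" using w by auto
  have UE': "\<Union>?E' = \<Union>E \<union> {w1, w2}" using v by auto
  fix M assume "M \<in> ?L"
  then have M: "M \<subseteq> ?E'" "\<Union>M = \<Union>E \<union> {w1, w2}" "\<And>e f. e \<in> M \<Longrightarrow> f \<in> M \<Longrightarrow> e \<noteq> f \<Longrightarrow> e \<inter> f = {}"
    using UE' unfolding perfect_matching_iff by auto
  show "M \<in> ?R1 \<union> ?R2"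
  proof (cases "{w1, w2} \<in> M")
    case True
    define N where "N = M - {{w1, w2}}"
    have dis: "\<forall>f\<in>N. f \<inter> {w1, w2} = {}"
      using M(3)[OF _ True] unfolding N_def by blast
    have "\<Union>N = \<Union>M - {w1, w2}"
      using dis True unfolding N_def by blast
    then have "\<Union>N = \<Union>E" using w M(2) by auto
    moreover have "N \<subseteq> E" using M(1) dis unfolding N_def by auto
    ultimately have "perfect_matching E N"
      using M(3) unfolding perfect_matching_iff N_def by auto
    moreover have "M = insert {w1, w2} N" using True unfolding N_def by auto
    ultimately show ?thesis by blast
  next
    case False
    have "w1 \<in> \<Union>M" "w2 \<in> \<Union>M" using M(2) by auto
    then have ab: "{v1, w1} \<in> M" "{v2, w2} \<in> M"
      using M(1) False w vw by auto
    define K where "K = M - {{v1, w1}, {v2, w2}}"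
    have dis: "\<forall>f\<in>K. f \<inter> {v1, v2, w1, w2} = {}"
      using M(3)[OF _ ab(1)] M(3)[OF _ ab(2)] unfolding K_def by blast
    have KE: "K \<subseteq> E" using M(1) False unfolding K_def by auto
    have MK: "M = K \<union> {{v1, w1}, {v2, w2}}" using ab unfolding K_def by auto
    define N where "N = insert {v1, v2} K"
    have "\<Union>N = \<Union>E"
    proof -
      have "\<Union>M = {v1, v2, w1, w2} \<union> \<Union>K" unfolding MK by auto
      moreover have "\<Union>K \<inter> {w1, w2} = {}" using dis by auto
      ultimately have "\<Union>K \<union> {v1, v2} = \<Union>M - {w1, w2}" using vw by auto
      also have "\<dots> = \<Union>E" using M(2) w(1,2) by auto
      finally show ?thesis unfolding N_def by auto
    qed
    moreover have "\<forall>e\<in>N. \<forall>f\<in>N. e \<noteq> f \<longrightarrow> e \<inter> f = {}"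
    proof -
      have "e \<inter> f = {}" if "e \<in> K" "f \<in> K" "e \<noteq> f" for e f
        using M(3) that unfolding K_def by simp
      moreover have "f \<inter> {v1, v2} = {}" "{v1, v2} \<inter> f = {}" if "f \<in> K" for f
        using dis that by auto
      ultimately show ?thesis unfolding N_def by (metis insertE)
    qed
    moreover have "N \<subseteq> E" using KE e(1) unfolding N_def by simp
    ultimately have "N \<in> {M. perfect_matching E M \<and> {v1, v2} \<in> M}"
      unfolding perfect_matching_iff by (simp add: N_def)
    moreover have "{v1, v2} \<notin> K" using dis by auto
    then have "M = N - {{v1, v2}} \<union> {{v1, w1}, {v2, w2}}"
      unfolding MK N_def by auto
    ultimately show ?thesis by blast
  qed
qed

text \<open>\<open>g\<close> will be the first glued edge. Whether it was chosen has to be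
  remembered along the whole snake, since goodness compares the two ends.\<close>

definition matchings_with :: "'v set set \<Rightarrow> 'v set \<Rightarrow> bool \<Rightarrow> 'v set \<Rightarrow> 'v set set set" where
  "matchings_with E g b e = {M. perfect_matching E M \<and> (g \<in> M \<longleftrightarrow> b) \<and> e \<in> M}"

definition matchings_without :: "'v set set \<Rightarrow> 'v set \<Rightarrow> bool \<Rightarrow> 'v set \<Rightarrow> 'v set set set" where
  "matchings_without E g b e = {M. perfect_matching E M \<and> (g \<in> M \<longleftrightarrow> b) \<and> e \<notin> M}"

lemma finite_perfect_matchings: "finite E \<Longrightarrow> finite {M. perfect_matching E M \<and> P M}"
  by (rule finite_subset[of _ "Pow E"]) (auto simp: perfect_matching_def)

text \<open>Each of the three new edges may carry the next tile or be glued, hence the six counts.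
  The far edge lies in exactly the extensions of the first kind, the side edges in exactly those of
  the second kind. The exchange removes only \<open>e\<close>, so the record of \<open>g\<close>
  survives.\<close>

lemma card_matchings_add_square:
  assumes e: "e = {v1, v2}" "e \<in> E" "v1 \<noteq> v2" and w: "w1 \<notin> \<Union>E" "w2 \<notin> \<Union>E" "w1 \<noteq> w2"
    and g: "g \<in> E" "g \<noteq> e" and fin: "finite E"
  defines "E' \<equiv> E \<union> {{v1, w1}, {v2, w2}, {w1, w2}}"
  shows "card (matchings_with E' g b {w1, w2}) =
           card (matchings_with E g b e) + card (matchings_without E g b e)" (is ?far1)
    and "card (matchings_without E' g b {w1, w2}) = card (matchings_with E g b e)" (is ?far2)
    and "card (matchings_with E' g b {v1, w1}) = card (matchings_with E g b e)" (is ?side1)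
    and "card (matchings_without E' g b {v1, w1}) =
           card (matchings_with E g b e) + card (matchings_without E g b e)" (is ?side2)
    and "card (matchings_with E' g b {v2, w2}) = card (matchings_with E g b e)" (is ?side3)
    and "card (matchings_without E' g b {v2, w2}) =
           card (matchings_with E g b e) + card (matchings_without E g b e)" (is ?side4)
proof -
  let ?\<phi> = "insert {w1, w2}"
  let ?\<psi> = "\<lambda>M. M - {e} \<union> {{v1, w1}, {v2, w2}}"
  let ?A = "{M. perfect_matching E M \<and> (g \<in> M \<longleftrightarrow> b)}"
  have PM: "{M. perfect_matching E' M} =
      ?\<phi> ` {M. perfect_matching E M} \<union> ?\<psi> ` {M. perfect_matching E M \<and> e \<in> M}"
    using Collect_perfect_matching_add_square[of v1 v2 E w1 w2] e w unfolding E'_def by simp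
  have new: "{v1, w1} \<notin> E" "{v2, w2} \<notin> E" "{w1, w2} \<notin> E" using w by auto
  then have nin: "{v1, w1} \<notin> M" "{v2, w2} \<notin> M" "{w1, w2} \<notin> M" if "perfect_matching E M" for M
    using that by (auto simp: perfect_matching_def)
  have vw: "v1 \<noteq> w1" "v1 \<noteq> w2" "v2 \<noteq> w1" "v2 \<noteq> w2" using e w by auto
  then have ne: "{w1, w2} \<noteq> {v1, w1}" "{w1, w2} \<noteq> {v2, w2}" "{v1, w1} \<noteq> {v2, w2}"
    using e(3) w(3) by (auto simp: doubleton_eq_iff)
  have g': "g \<noteq> {v1, w1}" "g \<noteq> {v2, w2}" "g \<noteq> {w1, w2}" using g new by auto
  \<comment> \<open>Selecting by a property commutes with the two kinds of extension;
    \<open>I\<close> and \<open>II\<close> below treat properties that leave only one kind.\<close>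
  have P: "{M. perfect_matching E' M \<and> Q M} =
      ?\<phi> ` {M. perfect_matching E M \<and> Q (?\<phi> M)} \<union> ?\<psi> ` {M. perfect_matching E M \<and> e \<in> M \<and> Q (?\<psi> M)}" for Q
  proof -
    have "{x \<in> f ` A \<union> h ` B. Q x} = f ` {a \<in> A. Q (f a)} \<union> h ` {a \<in> B. Q (h a)}"
      for f h :: "'a set set \<Rightarrow> 'a set set" and A B by blast
    moreover have "{M. perfect_matching E' M \<and> Q M} = {M \<in> {M. perfect_matching E' M}. Q M}"
      by simp
    ultimately show ?thesis unfolding PM by simp
  qed
  have inj\<phi>: "inj_on ?\<phi> ?A"
    by (intro inj_onI) (metis (mono_tags, lifting) insert_ident mem_Collect_eq nin(3))
  have inj\<psi>: "inj_on ?\<psi> (matchings_with E g b e)"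
  proof (rule inj_onI)
    fix M N assume a: "M \<in> matchings_with E g b e" "N \<in> matchings_with E g b e" "?\<psi> M = ?\<psi> N"
    then have "M - {e} = N - {e}"
      using nin(1,2)[of M] nin(1,2)[of N] unfolding matchings_with_def mem_Collect_eq by blast
    then show "M = N" using a(1,2) unfolding matchings_with_def mem_Collect_eq by blast
  qed
  have \<phi>: "{w1, w2} \<in> ?\<phi> M" "{v1, w1} \<notin> ?\<phi> M" "{v2, w2} \<notin> ?\<phi> M" "g \<in> ?\<phi> M \<longleftrightarrow> g \<in> M"
    and \<psi>: "{w1, w2} \<notin> ?\<psi> M" "{v1, w1} \<in> ?\<psi> M" "{v2, w2} \<in> ?\<psi> M" "g \<in> ?\<psi> M \<longleftrightarrow> g \<in> M"
    if "perfect_matching E M" for M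
    using nin[OF that] g' g(2) ne ne[symmetric] by (simp_all only: insert_iff Un_iff Diff_iff empty_iff) simp_all
  have I: "{M. perfect_matching E' M \<and> Q M} = ?\<phi> ` ?A"
    if "\<And>M. perfect_matching E M \<Longrightarrow> Q (?\<phi> M) \<longleftrightarrow> (g \<in> M \<longleftrightarrow> b)"
       "\<And>M. perfect_matching E M \<Longrightarrow> \<not> Q (?\<psi> M)" for Q
  proof -
    have "{M. perfect_matching E M \<and> Q (?\<phi> M)} = ?A" using that(1) by blast
    moreover have "{M. perfect_matching E M \<and> e \<in> M \<and> Q (?\<psi> M)} = {}" using that(2) by blast
    ultimately show ?thesis unfolding P by (simp only: image_empty Un_empty_right)
  qed
  have II: "{M. perfect_matching E' M \<and> Q M} = ?\<psi> ` matchings_with E g b e"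
    if "\<And>M. perfect_matching E M \<Longrightarrow> \<not> Q (?\<phi> M)"
       "\<And>M. perfect_matching E M \<Longrightarrow> Q (?\<psi> M) \<longleftrightarrow> (g \<in> M \<longleftrightarrow> b)" for Q
  proof -
    have "{M. perfect_matching E M \<and> Q (?\<phi> M)} = {}" using that(1) by blast
    moreover have "{M. perfect_matching E M \<and> e \<in> M \<and> Q (?\<psi> M)} = matchings_with E g b e"
      using that(2) unfolding matchings_with_def by blast
    ultimately show ?thesis unfolding P by (simp only: image_empty Un_empty_left)
  qed
  have I': "matchings_with E' g b {w1, w2} = ?\<phi> ` ?A"
    "matchings_without E' g b {v1, w1} = ?\<phi> ` ?A" "matchings_without E' g b {v2, w2} = ?\<phi> ` ?A"
    unfolding matchings_with_def matchings_without_def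
    by (rule I; use \<phi> \<psi> in \<open>simp only: simp_thms\<close>)+
  have II': "matchings_without E' g b {w1, w2} = ?\<psi> ` matchings_with E g b e"
    "matchings_with E' g b {v1, w1} = ?\<psi> ` matchings_with E g b e"
    "matchings_with E' g b {v2, w2} = ?\<psi> ` matchings_with E g b e"
    unfolding matchings_with_def[of E'] matchings_without_def
    by (rule II; use \<phi> \<psi> in \<open>simp only: simp_thms\<close>)+
  have "?A = matchings_with E g b e \<union> matchings_without E g b e"
    by (auto simp: matchings_with_def matchings_without_def)
  moreover have "finite ?A" using fin by (rule finite_perfect_matchings)
  moreover have "matchings_with E g b e \<inter> matchings_without E g b e = {}"
    by (auto simp: matchings_with_def matchings_without_def)
  ultimately have A: "card ?A = card (matchings_with E g b e) + card (matchings_without E g b e)"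
    by (metis card_Un_disjoint finite_Un)
  show ?far1 ?far2 ?side1 ?side2 ?side3 ?side4
    unfolding I' II' card_image[OF inj\<phi>] card_image[OF inj\<psi>] A by simp_all
qed

section \<open>Transfer matrices along a snake graph\<close>

definition exit_edge :: "pm list \<Rightarrow> nat \<Rightarrow> vertex set" where
  "exit_edge fs n = (if exits_east fs n then east (tile fs n) else north (tile fs n))"

definition tiles_upto :: "pm list \<Rightarrow> nat \<Rightarrow> vertex set set" where
  "tiles_upto fs n =
     (\<Union>j\<le>n. {south (tile fs j), north (tile fs j), west (tile fs j), east (tile fs j)})"

lemma tiles_upto_0: "tiles_upto fs 0 = {south (0, 0), north (0, 0), west (0, 0), east (0, 0)}"
  by (simp add: tiles_upto_def)

lemma tiles_upto_Suc:
  "tiles_upto fs (Suc n) = tiles_upto fs n \<union>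
     {south (tile fs (Suc n)), north (tile fs (Suc n)), west (tile fs (Suc n)), east (tile fs (Suc n))}"
  by (auto simp: tiles_upto_def atMost_Suc)

lemma finite_tiles_upto: "finite (tiles_upto fs n)"
  by (simp add: tiles_upto_def)

lemma exit_edge_in_tiles_upto: "exit_edge fs n \<in> tiles_upto fs n"
  by (auto simp: exit_edge_def tiles_upto_def)

lemma first_glued_edge_in_tiles_upto: "first_glued_edge fs \<in> tiles_upto fs n"
  unfolding first_glued_edge_def tiles_upto_def by (intro UN_I[of 0]) auto

lemmas tile_edge_defs = south_def north_def west_def east_def

lemma tile_sum: "fst (tile fs n) + snd (tile fs n) = n"
  by (induction n) auto

text \<open>Coordinate sums grow along the snake, so among the vertices so far only the north-east
  one of the last tile has a sum as large as n + 2. The two vertices that the next tile adds have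
  sums n + 2 and n + 3 and differ from it, so they are fresh.\<close>

lemma tiles_upto_vertex:
  assumes "v \<in> \<Union>(tiles_upto fs n)"
  shows "fst v + snd v < n + 2 \<or> v = tile fs n + (1, 1)"
  using assms
proof (induction n)
  case 0
  then show ?case by (auto simp: tiles_upto_0 tile_edge_defs)
next
  case (Suc n)
  obtain a b where ab: "tile fs (Suc n) = (a, b)" "a + b = Suc n"
    using tile_sum[of fs "Suc n"] by (metis prod.collapse)
  consider "v \<in> \<Union>(tiles_upto fs n)" | "v \<in> {(a, b), (a + 1, b), (a, b + 1), (a + 1, b + 1)}"
    using Suc.prems unfolding tiles_upto_Suc ab tile_edge_defs by auto
  then show ?case
  proof cases
    case 1
    then have "fst v + snd v < n + 2 \<or> v = tile fs n + (1, 1)" by (rule Suc.IH)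
    then show ?thesis using tile_sum[of fs n] by auto
  next
    case 2
    then show ?thesis using ab by auto
  qed
qed

text \<open>The north-east vertex of a tile has positive coordinates, whereas the south and west
  edges of tile 0 lie on the axes.\<close>

lemma exit_edge_neq_first_glued_edge: "exit_edge fs n \<noteq> first_glued_edge fs"
proof -
  have "tile fs n + (1, 1) \<in> exit_edge fs n"
    by (auto simp: exit_edge_def tile_edge_defs)
  moreover have "tile fs n + (1, 1) \<notin> first_glued_edge fs"
    by (cases "tile fs n") (auto simp: first_glued_edge_def tile_edge_defs)
  ultimately show ?thesis by metis
qed

definition count_with :: "pm list \<Rightarrow> nat \<Rightarrow> bool \<Rightarrow> int" where
  "count_with fs n b =
     int (card (matchings_with (tiles_upto fs n) (first_glued_edge fs) b (exit_edge fs n)))"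

definition count_without :: "pm list \<Rightarrow> nat \<Rightarrow> bool \<Rightarrow> int" where
  "count_without fs n b =
     int (card (matchings_without (tiles_upto fs n) (first_glued_edge fs) b (exit_edge fs n)))"

text \<open>Orientation alternates from tile to tile. Equal consecutive signs therefore make the
  snake turn, and the new exit edge is a side of the glued square; different signs make it go
  straight, and the exit edge is the far one.\<close>

lemma count_Suc:
  "count_with fs (Suc n) b =
     (if fs ! Suc n = fs ! n then count_with fs n b else count_with fs n b + count_without fs n b)"
  "count_without fs (Suc n) b =
     (if fs ! Suc n = fs ! n then count_with fs n b + count_without fs n b else count_with fs n b)"
proof -
  let ?c = "tile fs (Suc n)" and ?E = "tiles_upto fs n" and ?g = "first_glued_edge fs"
  let ?e = "exit_edge fs n"
  have new: "v \<notin> \<Union>?E" if "fst v + snd v \<ge> n + 2" "v \<noteq> tile fs n + (1, 1)" for v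
    using tiles_upto_vertex[of v fs n] that by auto
  have same: "exits_east fs (Suc n) \<longleftrightarrow> (exits_east fs n \<longleftrightarrow> fs ! Suc n \<noteq> fs ! n)"
    by (cases "fs ! n"; cases "fs ! Suc n") (auto simp: exits_east_def)
  note sq = card_matchings_add_square[where E = ?E and g = ?g and e = ?e and b = b,
      OF _ exit_edge_in_tiles_upto _ _ _ _ first_glued_edge_in_tiles_upto
      exit_edge_neq_first_glued_edge[symmetric] finite_tiles_upto]
  show "count_with fs (Suc n) b =
     (if fs ! Suc n = fs ! n then count_with fs n b else count_with fs n b + count_without fs n b)"
  "count_without fs (Suc n) b =
     (if fs ! Suc n = fs ! n then count_with fs n b + count_without fs n b else count_with fs n b)"
  proof (atomize (full), cases "exits_east fs n")
    case True
    then have c: "?c = tile fs n + (1, 0)" by simp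
    have e: "?e = {?c, ?c + (0, 1)}"
      using True by (cases "tile fs n") (simp add: exit_edge_def east_def c)
    have E: "tiles_upto fs (Suc n) =
        ?E \<union> {{?c, ?c + (1, 0)}, {?c + (0, 1), ?c + (1, 1)}, {?c + (1, 0), ?c + (1, 1)}}"
      using exit_edge_in_tiles_upto[of fs n] unfolding tiles_upto_Suc e
      by (auto simp: tile_edge_defs)
    have exit: "exit_edge fs (Suc n) =
        (if fs ! Suc n = fs ! n then {?c + (0, 1), ?c + (1, 1)} else {?c + (1, 0), ?c + (1, 1)})"
      using True same by (simp add: exit_edge_def tile_edge_defs)
    have w: "?c + (1, 0) \<notin> \<Union>?E" "?c + (1, 1) \<notin> \<Union>?E"
      by (rule new; use tile_sum[of fs n] c in \<open>cases "tile fs n"; auto\<close>)+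
    have d: "?c \<noteq> ?c + (0, 1)" "?c + (1, 0) \<noteq> ?c + (1, 1)" by (cases ?c; auto)+
    note s = sq[OF e d(1) w d(2), folded E]
    show "count_with fs (Suc n) b =
     (if fs ! Suc n = fs ! n then count_with fs n b else count_with fs n b + count_without fs n b) \<and>
      count_without fs (Suc n) b =
     (if fs ! Suc n = fs ! n then count_with fs n b + count_without fs n b else count_with fs n b)"
      unfolding count_with_def count_without_def exit using s by (simp split: if_splits)
  next
    case False
    then have c: "?c = tile fs n + (0, 1)" by simp
    have e: "?e = {?c, ?c + (1, 0)}"
      using False by (cases "tile fs n") (simp add: exit_edge_def north_def c)
    have E: "tiles_upto fs (Suc n) =
        ?E \<union> {{?c, ?c + (0, 1)}, {?c + (1, 0), ?c + (1, 1)}, {?c + (0, 1), ?c + (1, 1)}}"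
      using exit_edge_in_tiles_upto[of fs n] unfolding tiles_upto_Suc e
      by (auto simp: tile_edge_defs)
    have exit: "exit_edge fs (Suc n) =
        (if fs ! Suc n = fs ! n then {?c + (1, 0), ?c + (1, 1)} else {?c + (0, 1), ?c + (1, 1)})"
      using False same by (simp add: exit_edge_def tile_edge_defs)
    have w: "?c + (0, 1) \<notin> \<Union>?E" "?c + (1, 1) \<notin> \<Union>?E"
      by (rule new; use tile_sum[of fs n] c in \<open>cases "tile fs n"; auto\<close>)+
    have d: "?c \<noteq> ?c + (1, 0)" "?c + (0, 1) \<noteq> ?c + (1, 1)" by (cases ?c; auto)+
    note s = sq[OF e d(1) w d(2), folded E]
    show "count_with fs (Suc n) b =
     (if fs ! Suc n = fs ! n then count_with fs n b else count_with fs n b + count_without fs n b) \<and>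
      count_without fs (Suc n) b =
     (if fs ! Suc n = fs ! n then count_with fs n b + count_without fs n b else count_with fs n b)"
      unfolding count_with_def count_without_def exit using s by (simp split: if_splits)
  qed
qed

lemma perfect_matching_single:
  assumes "e \<noteq> {}"
  shows "{M. perfect_matching {e} M} = {{e}}" "{M. perfect_matching {e} M \<and> e \<in> M} = {{e}}"
  using assms unfolding perfect_matching_iff by auto

text \<open>A square is itself a square glued to the graph with a single edge.\<close>

lemma Collect_perfect_matching_square:
  "{M. perfect_matching (tiles_upto fs 0) M} =
     {{south (0, 0), north (0, 0)}, {west (0, 0), east (0, 0)}}"
proof -
  have E: "tiles_upto fs 0 = {{(0, 0), (1, 0)}} \<union>
      {{(0, 0), (0, 1)}, {(1, 0), (1, 1)}, {(0, 1), (1, 1)}}"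
    unfolding tiles_upto_0 tile_edge_defs by simp blast
  have "{M. perfect_matching (tiles_upto fs 0) M} =
      {{{(0, 1), (1, 1)}, {(0, 0), (1, 0)}}, {{(0, 0), (0, 1)}, {(1, 0), (1, 1)}}}"
    unfolding E
    by (subst Collect_perfect_matching_add_square)
      (simp_all only: perfect_matching_single insert_not_empty not_False_eq_True, auto)
  then show ?thesis
    unfolding tile_edge_defs by (simp add: insert_commute)
qed

lemma count_0:
  "count_with fs 0 b = of_bool (b \<longleftrightarrow> fs ! 0 \<noteq> last fs)"
  "count_without fs 0 b = of_bool (b \<longleftrightarrow> fs ! 0 = last fs)"
proof -
  have d: "south (0, 0) \<noteq> west (0, 0)" "south (0, 0) \<noteq> east (0, 0)" "north (0, 0) \<noteq> west (0, 0)"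
      "north (0, 0) \<noteq> east (0, 0)" "south (0, 0) \<noteq> north (0, 0)" "west (0, 0) \<noteq> east (0, 0)"
    by (auto simp: tile_edge_defs doubleton_eq_iff)
  have P: "{M. perfect_matching (tiles_upto fs 0) M \<and> Q M} =
      {M \<in> {{south (0, 0), north (0, 0)}, {west (0, 0), east (0, 0)}}. Q M}" for Q
    using Collect_perfect_matching_square[of fs] by blast
  let ?SN = "{south (0, 0), north (0, 0)}" and ?WE = "{west (0, 0), east (0, 0)}"
  have *: "card {M \<in> {?SN, ?WE}. Q M} = of_bool (Q ?SN) + of_bool (Q ?WE)" for Q
  proof -
    have "?SN \<noteq> ?WE" by (metis d(1,2) insertE insertI1 singletonD)
    moreover have "{M \<in> {?SN, ?WE}. Q M} =
        (if Q ?SN then {?SN} else {}) \<union> (if Q ?WE then {?WE} else {})" by auto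
    ultimately show ?thesis by (simp only:) (simp add: card_insert_if)
  qed
  show "count_with fs 0 b = of_bool (b \<longleftrightarrow> fs ! 0 \<noteq> last fs)"
    unfolding count_with_def matchings_with_def P * using d d[symmetric]
    by (cases "fs ! 0"; cases "last fs"; cases b)
      (simp_all add: exit_edge_def exits_east_def first_glued_edge_def)
  show "count_without fs 0 b = of_bool (b \<longleftrightarrow> fs ! 0 = last fs)"
    unfolding count_without_def matchings_without_def P * using d d[symmetric]
    by (cases "fs ! 0"; cases "last fs"; cases b)
      (simp_all add: exit_edge_def exits_east_def first_glued_edge_def)
qed

text \<open>The order of the two counts follows the sign. This merges the turning and the straight
  recursion into one multiplication, by the matrix of the old sign alone.\<close>

definition count_row :: "pm list \<Rightarrow> nat \<Rightarrow> bool \<Rightarrow> int^2" where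
  "count_row fs n b =
     (if fs ! n = Plus then vector [count_without fs n b, count_with fs n b]
      else vector [count_with fs n b, count_without fs n b])"

lemma count_row_Suc: "count_row fs (Suc n) b = count_row fs n b v* sign_matrix (fs ! n)"
  by (cases "fs ! n"; cases "fs ! Suc n")
    (simp_all add: count_row_def count_Suc vec_eq_iff forall_2 vector_matrix_mult_def sum_2)

text \<open>The matrix of the last sign is split off as if its tile came before tile 0; the entries
  -1 are what this leaves behind. The words below then become rotations of
  \<open>fs\<close>.\<close>

lemma count_row_0:
  "count_row fs 0 True = axis (if last fs = Plus then 1 else 2) 1 v* sign_matrix (last fs)"
  "count_row fs 0 False =
     (if last fs = Plus then vector [-1, 1] else vector [1, -1]) v* sign_matrix (last fs)"
  by (cases "fs ! 0"; cases "last fs";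
      simp add: count_row_def count_0 vec_eq_iff forall_2 vector_matrix_mult_def sum_2 axis_def)+

lemma vector_matrix_mul_assoc': "(x v* A) v* B = x v* (A ** B)" for x :: "'a::comm_semiring_1 ^ 'n"
  by (metis matrix_transpose_mul matrix_vector_mul_assoc transpose_matrix_vector)

lemma count_row_eq:
  assumes "n < length fs"
  shows "count_row fs n b =
     (if b then axis (if last fs = Plus then 1 else 2) 1
      else if last fs = Plus then vector [-1, 1] else vector [1, -1]) v*
       word_matrix (last fs # take n fs)"
  using assms
proof (induction n)
  case 0
  show ?case by (cases b) (simp_all add: count_row_0)
next
  case (Suc n)
  have "take (Suc n) fs = take n fs @ [fs ! n]"
    using Suc.prems by (simp add: take_Suc_conv_app_nth)
  then have "word_matrix (last fs # take (Suc n) fs) =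
      word_matrix (last fs # take n fs) ** sign_matrix (fs ! n)"
    by (simp add: word_matrix_append matrix_mul_assoc)
  then show ?case
    using Suc by (simp only: count_row_Suc vector_matrix_mul_assoc' Suc_lessD)
qed

text \<open>Let P be the product of the word with its last sign moved to the front; the trace does
  not notice the rotation. If that sign is \<open>Plus\<close>, the matchings with the first glued
  edge number P11 + P12, and those with the last glued edge only number P22 - P12. For
  \<open>Minus\<close> the two indices are exchanged.\<close>

lemma card_good_matchings:
  assumes "fs \<noteq> []"
  shows "int (card (good_matchings fs)) = trace (word_matrix fs)"
proof -
  define n where "n = length fs - 1"
  have n: "n < length fs" "length fs = Suc n" using assms by (simp_all add: n_def)
  let ?E = "tiles_upto fs n" and ?g = "first_glued_edge fs" and ?e = "exit_edge fs n"
  have E: "snake_edges fs = ?E"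
    by (simp add: snake_edges_def tiles_upto_def n lessThan_Suc_atMost)
  have e: "last_glued_edge fs = ?e"
    by (simp add: last_glued_edge_def exit_edge_def n)
  have "good_matchings fs = matchings_with ?E ?g True ?e \<union> matchings_without ?E ?g True ?e \<union>
      matchings_with ?E ?g False ?e"
    unfolding good_matchings_def E e matchings_with_def matchings_without_def by auto
  moreover have "finite (matchings_with ?E ?g b ?e)" "finite (matchings_without ?E ?g b ?e)" for b
    unfolding matchings_with_def matchings_without_def
    by (simp_all add: finite_perfect_matchings finite_tiles_upto)
  moreover have "matchings_with ?E ?g True ?e \<inter> matchings_without ?E ?g True ?e = {}"
    "(matchings_with ?E ?g True ?e \<union> matchings_without ?E ?g True ?e) \<inter>
      matchings_with ?E ?g False ?e = {}"
    unfolding matchings_with_def matchings_without_def by auto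
  ultimately have count: "int (card (good_matchings fs)) =
      count_with fs n True + count_without fs n True + count_with fs n False"
    by (simp add: count_with_def count_without_def card_Un_disjoint)
  have last: "fs ! n = last fs" using assms by (simp add: n_def last_conv_nth)
  have rot: "fs = take n fs @ [last fs]"
    using assms by (metis append_butlast_last_id butlast_conv_take n_def)
  have "trace (word_matrix fs) = trace (word_matrix (last fs # take n fs))"
    by (subst rot) (simp add: word_matrix_append trace_mul_sym[of "word_matrix (take n fs)"])
  moreover define P where "P = word_matrix (last fs # take n fs)"
  moreover note count_row_eq[OF n(1), of True, folded P_def] count_row_eq[OF n(1), of False, folded P_def]
  ultimately show ?thesis
    unfolding count
    by (cases "last fs")
      (simp_all add: count_row_def last vec_eq_iff forall_2 vector_matrix_mult_def sum_2 axis_def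
        trace_def)
qed

section \<open>Crossings of a line with the lattice\<close>

definition lattice_point :: "int \<Rightarrow> int \<Rightarrow> complex" where
  "lattice_point a b = Complex (of_int a) (of_int b)"

lemma lattice_point_simps [simp]:
  "Re (lattice_point a b) = of_int a" "Im (lattice_point a b) = of_int b"
  "lattice_point a b = lattice_point c d \<longleftrightarrow> a = c \<and> b = d"
  by (simp_all add: lattice_point_def)

lemma lattice_point_add: "lattice_point a b + lattice_point c d = lattice_point (a + c) (b + d)"
  by (simp add: complex_eq_iff)

lemma lattice_point_diff: "lattice_point a b - lattice_point c d = lattice_point (a - c) (b - d)"
  by (simp add: complex_eq_iff)

definition crosses :: "complex \<Rightarrow> complex \<Rightarrow> complex \<Rightarrow> bool" where
  "crosses z A B \<longleftrightarrow> (A, B) \<in> lattice_segments \<and> z \<in> open_segment A B"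

lemma crosses_horizontal:
  assumes "Im z = of_int b" "of_int a < Re z" "Re z < of_int a + 1"
  shows "crosses z (lattice_point a b) (lattice_point (a + 1) b)"
  unfolding crosses_def in_segment
proof (intro conjI exI[of _ "Re z - of_int a"])
  show "(lattice_point a b, lattice_point (a + 1) b) \<in> lattice_segments"
    by (auto simp: lattice_segments_def complex_eq_iff)
qed (use assms in \<open>auto simp: complex_eq_iff algebra_simps\<close>)

lemma crosses_vertical:
  assumes "Re z = of_int a" "of_int b < Im z" "Im z < of_int b + 1"
  shows "crosses z (lattice_point a b) (lattice_point a (b + 1))"
  unfolding crosses_def in_segment
proof (intro conjI exI[of _ "Im z - of_int b"])
  show "(lattice_point a b, lattice_point a (b + 1)) \<in> lattice_segments"
    by (auto simp: lattice_segments_def complex_eq_iff)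
qed (use assms in \<open>auto simp: complex_eq_iff algebra_simps\<close>)

lemma crosses_diagonal:
  assumes "Re z + Im z = of_int (a + b)" "of_int a < Re z" "Re z < of_int a + 1"
  shows "crosses z (lattice_point a b) (lattice_point (a + 1) (b - 1))"
  unfolding crosses_def in_segment
proof (intro conjI exI[of _ "Re z - of_int a"])
  show "(lattice_point a b, lattice_point (a + 1) (b - 1)) \<in> lattice_segments"
    by (auto simp: lattice_segments_def complex_eq_iff)
qed (use assms in \<open>auto simp: complex_eq_iff algebra_simps\<close>)

lemma crosses_cases:
  assumes "crosses z A B"
  obtains
    (horizontal) a b where "A = lattice_point a b" "B = lattice_point (a + 1) b"
      "Im z = of_int b" "of_int a < Re z" "Re z < of_int a + 1"
  | (vertical) a b where "A = lattice_point a b" "B = lattice_point a (b + 1)"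
      "Re z = of_int a" "of_int b < Im z" "Im z < of_int b + 1"
  | (diagonal) a b where "A = lattice_point a b" "B = lattice_point (a + 1) (b - 1)"
      "Re z + Im z = of_int (a + b)" "of_int a < Re z" "Re z < of_int a + 1"
proof -
  obtain a b where ab: "Re A = of_int a" "Im A = of_int b" and B: "B - A \<in> {1, \<i>, 1 - \<i>}"
    using assms unfolding crosses_def lattice_segments_def by (auto elim!: Ints_cases)
  obtain u where u: "0 < u" "u < 1" "z = (1 - u) *\<^sub>R A + u *\<^sub>R B"
    using assms unfolding crosses_def in_segment by auto
  then have z: "z = A + u *\<^sub>R (B - A)" by (simp add: algebra_simps)
  have A: "A = lattice_point a b" using ab by (simp add: complex_eq_iff)
  from B consider "B = A + 1" | "B = A + \<i>" | "B = A + (1 - \<i>)"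
    by (auto simp: algebra_simps)
  then show thesis
  proof cases
    case 1
    show thesis by (rule horizontal[of a b]) (use 1 A z u in \<open>auto simp: complex_eq_iff\<close>)
  next
    case 2
    show thesis by (rule vertical[of a b]) (use 2 A z u in \<open>auto simp: complex_eq_iff\<close>)
  next
    case 3
    show thesis by (rule diagonal[of a b]) (use 3 A z u in \<open>auto simp: complex_eq_iff\<close>)
  qed
qed

lemma strictly_between_not_Ints: "of_int a < x \<Longrightarrow> x < of_int a + 1 \<Longrightarrow> x \<notin> \<int>" for x :: real
  by (auto elim!: Ints_cases)

text \<open>The integrality of the coordinates reveals the direction and the floors reveal the
  position. So a point lies in at most one open segment, which is what the definite description in
  \<open>ends_at\<close> needs.\<close>

lemma crosses_floor:
  assumes "crosses z A B"
  shows "(A, B) =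
    (if Im z \<in> \<int> then (lattice_point \<lfloor>Re z\<rfloor> \<lfloor>Im z\<rfloor>, lattice_point (\<lfloor>Re z\<rfloor> + 1) \<lfloor>Im z\<rfloor>)
     else if Re z \<in> \<int> then (lattice_point \<lfloor>Re z\<rfloor> \<lfloor>Im z\<rfloor>, lattice_point \<lfloor>Re z\<rfloor> (\<lfloor>Im z\<rfloor> + 1))
     else (lattice_point \<lfloor>Re z\<rfloor> (\<lfloor>Im z\<rfloor> + 1), lattice_point (\<lfloor>Re z\<rfloor> + 1) \<lfloor>Im z\<rfloor>))"
  using assms
proof (cases rule: crosses_cases)
  case (horizontal a b)
  then have "\<lfloor>Re z\<rfloor> = a" by (simp add: floor_eq_iff)
  then show ?thesis using horizontal by simp
next
  case (vertical a b)
  then have "\<lfloor>Im z\<rfloor> = b" by (simp add: floor_eq_iff)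
  moreover have "Im z \<notin> \<int>" using vertical by (simp add: strictly_between_not_Ints)
  ultimately show ?thesis using vertical by simp
next
  case (diagonal a b)
  then have "\<lfloor>Re z\<rfloor> = a" "\<lfloor>Im z\<rfloor> = b - 1" by (simp_all add: floor_eq_iff)
  moreover have "Re z \<notin> \<int>" using diagonal by (simp add: strictly_between_not_Ints)
  moreover have "Im z \<notin> \<int>"
    using diagonal by (intro strictly_between_not_Ints[of "b - 1"]) simp_all
  ultimately show ?thesis using diagonal by simp
qed

lemma ends_at_eq:
  assumes "crosses (\<gamma> t) A B"
  shows "ends_at \<gamma> t = {A, B}"
  unfolding ends_at_def
proof (rule the_equality)
  show "\<exists>A' B'. {A, B} = {A', B'} \<and> (A', B') \<in> lattice_segments \<and> \<gamma> t \<in> open_segment A' B'"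
    using assms unfolding crosses_def by blast
  fix E
  assume "\<exists>A' B'. E = {A', B'} \<and> (A', B') \<in> lattice_segments \<and> \<gamma> t \<in> open_segment A' B'"
  then obtain A' B' where E: "E = {A', B'}" and c: "crosses (\<gamma> t) A' B'"
    unfolding crosses_def by blast
  have "(A', B') = (A, B)"
    using crosses_floor[OF assms] crosses_floor[OF c] by (simp only:)
  then show "E = {A, B}" using E by simp
qed

text \<open>The lines of the three families are the disjoint union of the open segments and the
  lattice points.\<close>

lemma ex_crosses_iff:
  "(\<exists>A B. crosses z A B) \<longleftrightarrow>
     (Re z \<in> \<int> \<or> Im z \<in> \<int> \<or> Re z + Im z \<in> \<int>) \<and> \<not> (Re z \<in> \<int> \<and> Im z \<in> \<int>)"
proof
  assume "\<exists>A B. crosses z A B"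
  then obtain A B where "crosses z A B" by blast
  then show "(Re z \<in> \<int> \<or> Im z \<in> \<int> \<or> Re z + Im z \<in> \<int>) \<and> \<not> (Re z \<in> \<int> \<and> Im z \<in> \<int>)"
    by (cases rule: crosses_cases) (auto dest: strictly_between_not_Ints)
next
  assume a: "(Re z \<in> \<int> \<or> Im z \<in> \<int> \<or> Re z + Im z \<in> \<int>) \<and> \<not> (Re z \<in> \<int> \<and> Im z \<in> \<int>)"
  have fl: "of_int \<lfloor>x\<rfloor> < x \<and> x < of_int \<lfloor>x\<rfloor> + 1" if "x \<notin> \<int>" for x :: real
    using that of_int_floor_le[of x] floor_less_iff[of x "\<lfloor>x\<rfloor> + 1"]
    by (metis Ints_of_int floor_correct less_eq_real_def of_int_1 of_int_add)
  consider "Im z \<in> \<int>" "Re z \<notin> \<int>" | "Re z \<in> \<int>" "Im z \<notin> \<int>" | "Re z + Im z \<in> \<int>" "Re z \<notin> \<int>"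
    using a Ints_diff[of "Re z + Im z" "Re z"] by auto
  then show "\<exists>A B. crosses z A B"
  proof cases
    case 1
    then obtain b where "Im z = of_int b" by (auto elim: Ints_cases)
    then show ?thesis using crosses_horizontal fl[OF 1(2)] by blast
  next
    case 2
    then obtain a where "Re z = of_int a" by (auto elim: Ints_cases)
    then show ?thesis using crosses_vertical fl[OF 2(2)] by blast
  next
    case 3
    then obtain c where "Re z + Im z = of_int c" by (auto elim: Ints_cases)
    then have "Re z + Im z = of_int (\<lfloor>Re z\<rfloor> + (c - \<lfloor>Re z\<rfloor>))" by simp
    then show ?thesis using crosses_diagonal fl[OF 3(2)] by blast
  qed
qed

lemma crossing_times_eq:
  assumes "sorted_wrt (<) ts" and "set ts = {t \<in> T. \<exists>A B. crosses (\<gamma> t) A B}"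
  shows "crossing_times \<gamma> T = ts"
proof -
  have "crossing_times \<gamma> T = sorted_list_of_set {t \<in> T. \<exists>A B. crosses (\<gamma> t) A B}"
    unfolding crossing_times_def crosses_def by (rule arg_cong[of _ _ sorted_list_of_set]) auto
  also have "\<dots> = ts"
    unfolding assms(2)[symmetric]
    by (rule strict_sorted_equal) (use assms(1) in \<open>simp_all add: strict_sorted_list_of_set\<close>)
  finally show ?thesis .
qed

lemma crosses_translate:
  assumes "crosses z A B"
  shows "crosses (lattice_point a b + z) (lattice_point a b + A) (lattice_point a b + B)"
  using assms unfolding crosses_def lattice_segments_def open_segment_translation_eq by auto

lemma crosses_reflect:
  assumes "crosses z A B"
  shows "crosses (lattice_point a b - z) (lattice_point a b - B) (lattice_point a b - A)"
proof -
  let ?w = "lattice_point a b"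
  obtain u where u: "0 < u" "u < 1" "z = (1 - u) *\<^sub>R A + u *\<^sub>R B" "A \<noteq> B"
    using assms unfolding crosses_def in_segment by auto
  have "?w - z = (1 - (1 - u)) *\<^sub>R (?w - B) + (1 - u) *\<^sub>R (?w - A)"
    unfolding u(3) by (simp add: algebra_simps)
  then have "?w - z \<in> open_segment (?w - B) (?w - A)"
    unfolding in_segment using u by (intro conjI exI[of _ "1 - u"]) auto
  moreover have AB: "Re A \<in> \<int>" "Im A \<in> \<int>" "B - A \<in> {1, \<i>, 1 - \<i>}"
    using assms unfolding crosses_def lattice_segments_def by auto
  from AB(3) have "B \<in> {A + 1, A + \<i>, A + (1 - \<i>)}" by (auto simp: algebra_simps)
  then have "Re B \<in> \<int>" "Im B \<in> \<int>" using AB(1,2) by auto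
  then have "(?w - B, ?w - A) \<in> lattice_segments"
    using AB(3) by (auto simp: lattice_segments_def)
  ultimately show ?thesis by (simp add: crosses_def)
qed

section \<open>Signs in terms of heights\<close>

definition height :: "complex \<Rightarrow> complex \<Rightarrow> real" where
  "height v P = Im (cnj v * P)"

lemma height_simps [simp]:
  "height v (P + Q) = height v P + height v Q" "height v (P - Q) = height v P - height v Q"
  "height v (x *\<^sub>R P) = x * height v P" "height v v = 0" "height v 0 = 0"
  "height v (of_real x * P) = x * height v P"
  by (simp_all add: height_def algebra_simps)

lemma crossing_sign_between:
  assumes "ends_at \<gamma> t = {L, R}" "left_of \<gamma> t L" "right_of \<gamma> t R"
  shows "crossing_sign s \<gamma> t =
    (if dist (\<gamma> t) R < dist (\<gamma> t) L then Minus
     else if dist (\<gamma> t) L < dist (\<gamma> t) R then Plus else s)"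
proof -
  have n: "\<not> left_of \<gamma> t R" "\<not> right_of \<gamma> t L"
    using assms(2,3) by (auto simp: left_of_def right_of_def)
  have "(THE P. P \<in> ends_at \<gamma> t \<and> left_of \<gamma> t P) = L"
    "(THE P. P \<in> ends_at \<gamma> t \<and> right_of \<gamma> t P) = R"
    using assms n by (auto intro!: the_equality)
  then show ?thesis by (simp add: crossing_sign_def)
qed

text \<open>A crossing at height \<open>h\<close> is closer to the right, that is the lower,
  endpoint exactly if \<open>h\<close> is below the mean of the two endpoint heights. In this form
  the sign needs neither a distance nor the crossing point.\<close>

definition edge_sign :: "pm \<Rightarrow> complex \<Rightarrow> real \<Rightarrow> complex set \<Rightarrow> pm" where
  "edge_sign s v h E =
     (if 2 * h < sum (height v) E then Minus else if sum (height v) E < 2 * h then Plus else s)"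

definition edge_corner_sign :: "complex \<Rightarrow> real \<Rightarrow> complex set \<Rightarrow> complex set \<Rightarrow> pm" where
  "edge_corner_sign v h E E' = (if \<exists>P \<in> E \<inter> E'. height v P < h then Minus else Plus)"

fun edge_signs :: "pm \<Rightarrow> complex \<Rightarrow> real \<Rightarrow> complex set list \<Rightarrow> pm list" where
  "edge_signs s v h [] = []"
| "edge_signs s v h [E] = [edge_sign s v h E]"
| "edge_signs s v h (E # E' # Es) =
     edge_sign s v h E # edge_corner_sign v h E E' # edge_signs s v h (E' # Es)"

text \<open>With the crossing at fraction u of the segment, distances and height differences are
  multiples of u and 1 - u by common factors, so both criteria compare u with 1/2.\<close>

lemma crossing_sign_straight:
  assumes c: "crosses (\<gamma> t) A B" and ne: "height v A \<noteq> height v B"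
    and v: "vector_derivative \<gamma> (at t) = v"
  shows "crossing_sign s \<gamma> t = edge_sign s v (height v (\<gamma> t)) {A, B}"
proof -
  define z where "z = \<gamma> t"
  have AB: "A \<noteq> B" using ne by auto
  obtain u where u: "0 < u" "u < 1" "z = (1 - u) *\<^sub>R A + u *\<^sub>R B"
    using c unfolding crosses_def in_segment z_def by auto
  have E: "ends_at \<gamma> t = {A, B}" using c by (rule ends_at_eq)
  have hz: "height v z = (1 - u) * height v A + u * height v B"
    unfolding u(3) by simp
  have side: "left_of \<gamma> t P \<longleftrightarrow> 0 < height v P - height v z"
    "right_of \<gamma> t P \<longleftrightarrow> height v P - height v z < 0" for P
    unfolding left_of_def right_of_def v z_def[symmetric] height_def[symmetric] by simp_all
  have d: "height v A - height v z = u * (height v A - height v B)"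
    "height v B - height v z = - ((1 - u) * (height v A - height v B))"
    "height v A + height v B - 2 * height v z = (2 * u - 1) * (height v A - height v B)"
    unfolding hz by (simp_all add: algebra_simps)
  have "z - A = u *\<^sub>R (B - A)" "z - B = (1 - u) *\<^sub>R (A - B)"
    unfolding u(3) by (simp_all add: algebra_simps)
  then have "dist z A = u * dist A B" "dist z B = (1 - u) * dist A B"
    using u by (simp_all add: dist_norm norm_minus_commute)
  then have dist: "dist z A < dist z B \<longleftrightarrow> u < 1 / 2" "dist z B < dist z A \<longleftrightarrow> 1 / 2 < u"
    using AB by (auto simp: mult_less_cancel_right)
  consider "height v A > height v B" | "height v A < height v B" using ne by linarith
  then show ?thesis
  proof cases
    case 1
    then have "left_of \<gamma> t A" "right_of \<gamma> t B"
      unfolding side d using u by (simp_all add: zero_less_mult_iff mult_less_0_iff)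
    moreover have "2 * height v z < height v A + height v B \<longleftrightarrow> 1 / 2 < u"
      "height v A + height v B < 2 * height v z \<longleftrightarrow> u < 1 / 2"
    proof -
      have "0 < (2 * u - 1) * (height v A - height v B) \<longleftrightarrow> 0 < 2 * u - 1"
        "(2 * u - 1) * (height v A - height v B) < 0 \<longleftrightarrow> 2 * u - 1 < 0"
        using 1 by (simp_all add: zero_less_mult_iff mult_less_0_iff)
      then show "2 * height v z < height v A + height v B \<longleftrightarrow> 1 / 2 < u"
        "height v A + height v B < 2 * height v z \<longleftrightarrow> u < 1 / 2"
        unfolding d(3)[symmetric] by auto
    qed
    ultimately show ?thesis
      using crossing_sign_between[of \<gamma> t A B s] E AB dist
      by (auto simp: edge_sign_def z_def)
  next
    case 2
    then have "left_of \<gamma> t B" "right_of \<gamma> t A"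
      unfolding side d using u by (simp_all add: zero_less_mult_iff mult_less_0_iff)
    moreover have "2 * height v z < height v A + height v B \<longleftrightarrow> u < 1 / 2"
      "height v A + height v B < 2 * height v z \<longleftrightarrow> 1 / 2 < u"
    proof -
      have "0 < (2 * u - 1) * (height v A - height v B) \<longleftrightarrow> 2 * u - 1 < 0"
        "(2 * u - 1) * (height v A - height v B) < 0 \<longleftrightarrow> 0 < 2 * u - 1"
        using 2 by (simp_all add: zero_less_mult_iff mult_less_0_iff)
      then show "2 * height v z < height v A + height v B \<longleftrightarrow> u < 1 / 2"
        "height v A + height v B < 2 * height v z \<longleftrightarrow> 1 / 2 < u"
        unfolding d(3)[symmetric] by auto
    qed
    ultimately show ?thesis
      using crossing_sign_between[of \<gamma> t B A s] E AB dist
      by (auto simp: edge_sign_def z_def insert_commute)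
  qed
qed

lemma corner_sign_straight:
  assumes v: "vector_derivative \<gamma> (at t) = v"
  shows "corner_sign \<gamma> t t' = edge_corner_sign v (height v (\<gamma> t)) (ends_at \<gamma> t) (ends_at \<gamma> t')"
proof -
  have "right_of \<gamma> t P \<longleftrightarrow> height v P < height v (\<gamma> t)" for P
    unfolding right_of_def v height_def[symmetric] by simp
  then show ?thesis by (simp add: corner_sign_def edge_corner_sign_def)
qed

lemma inner_signs_straight:
  assumes "\<And>t. t \<in> set ts \<Longrightarrow> vector_derivative \<gamma> (at t) = v \<and> height v (\<gamma> t) = h \<and>
             (\<exists>A B. crosses (\<gamma> t) A B \<and> height v A \<noteq> height v B)"
  shows "inner_signs s \<gamma> ts = edge_signs s v h (map (ends_at \<gamma>) ts)"
proof -
  have cross: "crossing_sign s \<gamma> t = edge_sign s v h (ends_at \<gamma> t)" if "t \<in> set ts" for t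
    using assms[OF that] crossing_sign_straight[of \<gamma> t _ _ v s] ends_at_eq[of \<gamma> t] by metis
  have corner: "corner_sign \<gamma> t t' = edge_corner_sign v h (ends_at \<gamma> t) (ends_at \<gamma> t')"
    if "t \<in> set ts" for t t'
    using assms[OF that] corner_sign_straight[of \<gamma> t v t'] by simp
  have "inner_signs s \<gamma> us = edge_signs s v h (map (ends_at \<gamma>) us)" if "set us \<subseteq> set ts" for us
    using that by (induction us rule: induct_list012) (simp_all add: cross corner)
  then show ?thesis by simp
qed

lemma edge_signs_append:
  assumes "Es \<noteq> []" "Fs \<noteq> []"
  shows "edge_signs s v h (Es @ Fs) =
           edge_signs s v h Es @ edge_corner_sign v h (last Es) (hd Fs) # edge_signs s v h Fs"
  using assms
proof (induction Es rule: induct_list012)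
  case (2 E)
  then show ?case by (cases Fs) auto
qed auto

lemma inner_signs_append:
  assumes "ts \<noteq> []" "us \<noteq> []"
  shows "inner_signs s \<gamma> (ts @ us) =
           inner_signs s \<gamma> ts @ corner_sign \<gamma> (last ts) (hd us) # inner_signs s \<gamma> us"
  using assms
proof (induction ts rule: induct_list012)
  case (2 t)
  then show ?case by (cases us) auto
qed auto

text \<open>The line at height \<open>h\<close> and the parallel line at height \<open>0\<close> have no lattice point in between, so
  that moving one to the other only settles the signs at midpoints.\<close>

lemma edge_signs_perturb:
  assumes "\<And>E P. E \<in> set Es \<Longrightarrow> P \<in> E \<Longrightarrow> height v P \<in> \<int> - {0}" and h: "\<bar>h\<bar> < 1 / 2"
  shows "edge_signs s v h Es =
           edge_signs (if 0 < h then Plus else if h < 0 then Minus else s) v 0 Es"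
    (is "_ = edge_signs ?s v 0 Es")
proof -
  have int: "2 * h < x \<longleftrightarrow> 0 < x \<or> x = 0 \<and> h < 0" "x < 2 * h \<longleftrightarrow> x < 0 \<or> x = 0 \<and> 0 < h"
    "x \<noteq> 0 \<Longrightarrow> x < h \<longleftrightarrow> x < 0" if x: "x \<in> \<int>" for x
  proof -
    obtain i where i: "x = of_int i" using x by (auto elim: Ints_cases)
    have "i \<ge> 1 \<or> i = 0 \<or> i \<le> -1" by linarith
    then have "x \<ge> 1 \<or> x = 0 \<or> x \<le> -1" unfolding i by linarith
    then show "2 * h < x \<longleftrightarrow> 0 < x \<or> x = 0 \<and> h < 0" "x < 2 * h \<longleftrightarrow> x < 0 \<or> x = 0 \<and> 0 < h"
      "x \<noteq> 0 \<Longrightarrow> x < h \<longleftrightarrow> x < 0" using h by auto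
  qed
  have edge: "edge_sign s v h E = edge_sign ?s v 0 E" if "E \<in> set Es" for E
  proof -
    have "sum (height v) E \<in> \<int>" using assms(1)[OF that] by (intro Ints_sum) auto
    from int(1,2)[OF this] show ?thesis by (auto simp: edge_sign_def)
  qed
  have corner: "edge_corner_sign v h E F = edge_corner_sign v 0 E F" if "E \<in> set Es" for E F
  proof -
    have "height v P < h \<longleftrightarrow> height v P < 0" if "P \<in> E" for P
      using assms(1)[OF \<open>E \<in> set Es\<close> that] int(3)[of "height v P"] by auto
    then show ?thesis unfolding edge_corner_sign_def by auto
  qed
  have "edge_signs s v h Fs = edge_signs ?s v 0 Fs" if "set Fs \<subseteq> set Es" for Fs
    using that by (induction Fs rule: induct_list012) (simp_all add: edge corner)
  then show ?thesis by simp
qed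

lemma edge_signs_translate:
  assumes "height v w = 0"
  shows "edge_signs s v h (map ((`) ((+) w)) Es) = edge_signs s v h Es"
proof -
  have inj: "inj_on ((+) w) E" for E by simp
  have edge: "edge_sign s v h ((+) w ` E) = edge_sign s v h E" for E
    using assms by (simp add: edge_sign_def sum.reindex o_def)
  have corner: "edge_corner_sign v h ((+) w ` E) ((+) w ` F) = edge_corner_sign v h E F" for E F
  proof -
    have "(+) w ` E \<inter> (+) w ` F = (+) w ` (E \<inter> F)" by auto
    then show ?thesis using assms by (simp add: edge_corner_sign_def)
  qed
  show ?thesis
    by (induction Es rule: induct_list012) (simp_all add: edge corner)
qed

text \<open>Reflection reverses the order and negates heights. A corner sign defaults to
  \<open>Plus\<close> if no common endpoint is on the right, so it flips only because there is
  exactly one common endpoint and that one is off the line.\<close>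

lemma edge_signs_reflect:
  assumes "height v w = 0"
    and "successively (\<lambda>E F. \<exists>P. E \<inter> F = {P} \<and> height v P \<noteq> 0) Es"
  shows "edge_signs (flip_sign s) v 0 (rev (map ((`) ((-) w)) Es)) =
           rev (map flip_sign (edge_signs s v 0 Es))"
  using assms(2)
proof (induction Es rule: induct_list012)
  case (2 E)
  have "edge_sign (flip_sign s) v 0 ((-) w ` E) = flip_sign (edge_sign s v 0 E)" for E
    using assms(1) by (simp add: edge_sign_def sum.reindex o_def sum_negf)
  then show ?case by simp
next
  case (3 E F Es)
  have edge: "edge_sign (flip_sign s) v 0 ((-) w ` E) = flip_sign (edge_sign s v 0 E)"
    using assms(1) by (simp add: edge_sign_def sum.reindex o_def sum_negf)
  obtain P where P: "E \<inter> F = {P}" "height v P \<noteq> 0" using "3.prems" by auto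
  then have "(-) w ` F \<inter> (-) w ` E = {w - P}" by auto
  then have corner: "edge_corner_sign v 0 ((-) w ` F) ((-) w ` E) = flip_sign (edge_corner_sign v 0 E F)"
    using P assms(1) by (auto simp: edge_corner_sign_def)
  have "edge_signs (flip_sign s) v 0 (rev (map ((`) ((-) w)) (E # F # Es))) =
      edge_signs (flip_sign s) v 0 (rev (map ((`) ((-) w)) (F # Es)) @ [(-) w ` E])"
    by simp
  also have "\<dots> = rev (map flip_sign (edge_signs s v 0 (F # Es))) @
      [flip_sign (edge_corner_sign v 0 E F), flip_sign (edge_sign s v 0 E)]"
    using "3.IH"(2) "3.prems" by (subst edge_signs_append) (simp_all add: edge corner)
  finally show ?case by simp
qed simp

text \<open>\<open>x\<close> and both ends of the interval are multiples of 1/m, so \<open>x\<close>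
  keeps a distance of at least 1/m from the ends, which is more than the shift.\<close>

lemma perturb_between:
  fixes m x h :: real
  assumes "of_int a < x" "x < of_int a + 1" "m * x \<in> \<int>" "m * of_int a \<in> \<int>" "m \<in> \<int>" "m > 0" "\<bar>h\<bar> < 1"
  shows "of_int a < x + h / m" "x + h / m < of_int a + 1"
proof -
  obtain i j k where ijk: "m * x = of_int i" "m * of_int a = of_int j" "m = of_int k"
    using assms(3-5) by (metis Ints_cases)
  have "of_int j < (of_int i :: real)" "of_int i < (of_int j + of_int k :: real)"
    unfolding ijk[symmetric] using assms(1,2,6) mult_strict_left_mono[of x "of_int a + 1" m]
    by (simp_all add: algebra_simps)
  then have "j + 1 \<le> i" "i \<le> j + k - 1" by linarith+
  then have "of_int j + 1 \<le> (of_int i :: real)" "of_int i \<le> (of_int j + of_int k - 1 :: real)"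
    by linarith+
  then have "m * of_int a + 1 \<le> m * x" "m * x \<le> m * of_int a + m - 1"
    unfolding ijk[symmetric] by simp_all
  moreover have "m * (x + h / m) = m * x + h" using assms(6) by (simp add: field_simps)
  ultimately have "m * of_int a < m * (x + h / m)" "m * (x + h / m) < m * (of_int a + 1)"
    using assms(7) by (simp_all add: algebra_simps)
  then show "of_int a < x + h / m" "x + h / m < of_int a + 1"
    using assms(6) by simp_all
qed

section \<open>The straight segment and its parallels\<close>

locale slope =
  fixes q p :: nat
  assumes p_pos: "0 < p" and q_pos: "0 < q" and coprime_pq: "coprime p q"
begin

definition v :: complex where "v = lattice_point (int q) (int p)"

definition line :: "complex \<Rightarrow> real \<Rightarrow> complex" where
  "line z t = z + of_real t * v"

lemma v_simps [simp]: "Re v = real q" "Im v = real p"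
  by (simp_all add: v_def)

lemma line_simps [simp]:
  "Re (line z t) = Re z + t * real q" "Im (line z t) = Im z + t * real p"
  by (simp_all add: line_def)

lemma height_v: "height v P = real q * Im P - real p * Re P"
  by (simp add: height_def)

lemma height_lattice_point:
  "height v (lattice_point a b) = of_int (int q * b - int p * a)"
  by (simp add: height_v)

lemma height_line [simp]: "height v (line z t) = height v z"
  by (simp add: height_v algebra_simps)

lemma vector_derivative_line: "vector_derivative (line z) (at t) = v"
  unfolding line_def
  by (rule vector_derivative_at) (auto intro!: derivative_eq_intros simp: has_vector_derivative_def scaleR_conv_of_real)

lemma line_add: "line z (t + real n) = lattice_point (int (n * q)) (int (n * p)) + line z t"
  by (simp add: complex_eq_iff algebra_simps)

lemma crosses_height:
  assumes "crosses z A B"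
  shows "height v A \<noteq> height v B" "height v A \<in> \<int>" "height v B \<in> \<int>"
  using assms p_pos q_pos
  by (cases rule: crosses_cases; simp add: height_v algebra_simps)+

text \<open>Along the segment from 0 to \<open>v\<close> the values of Im, Re and Re + Im are p t, q
  t and (p + q) t. No lattice point lies inside the segment, so an integer value always means a
  crossing.\<close>

definition base_times :: "real set" where
  "base_times = {t. 0 < t \<and> t < 1 \<and> (\<exists>m\<in>{p, q, p + q}. real m * t \<in> \<int>)}"

definition base_list :: "real list" where
  "base_list = sorted_list_of_set base_times"

lemma multiple_cases:
  assumes "real m * t \<in> \<int>" "0 < t" "t < 1" "0 < m"
  obtains c where "1 \<le> c" "c \<le> int m - 1" "t = of_int c / real m"
proof -
  obtain c where c: "real m * t = of_int c" using assms(1) by (auto elim: Ints_cases)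
  then have t: "t = of_int c / real m" using assms(4) by (simp add: field_simps)
  have "0 < real m * t" "real m * t < real m" using assms by simp_all
  then have "0 < (of_int c :: real)" "of_int c < real m"
    unfolding c .
  then have "1 \<le> c" "c \<le> int m - 1" by linarith+
  then show thesis using t by (rule that)
qed

text \<open>Crossing times are fractions with denominator at most p + q. The margin at both ends is
  the room for the half-circles.\<close>

lemma base_bounds:
  assumes "t \<in> base_times"
  shows "1 / real (p + q) \<le> t" "t \<le> 1 - 1 / real (p + q)"
proof -
  obtain m where m: "m \<in> {p, q, p + q}" "real m * t \<in> \<int>" "0 < t" "t < 1"
    using assms unfolding base_times_def by blast
  have pos: "0 < m" using m(1) p_pos q_pos by auto
  obtain c where c: "1 \<le> c" "c \<le> int m - 1" "t = of_int c / real m"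
    using multiple_cases[OF m(2,3,4) pos] .
  have "1 / real (p + q) \<le> 1 / real m"
    using m(1) pos by (intro divide_left_mono) auto
  moreover have "1 / real m \<le> t" "t \<le> (real m - 1) / real m"
    unfolding c(3) using c(1,2) pos by (auto intro!: divide_right_mono)
  moreover have "(real m - 1) / real m = 1 - 1 / real m" using pos by (simp add: field_simps)
  ultimately show "1 / real (p + q) \<le> t" "t \<le> 1 - 1 / real (p + q)" by linarith+
qed

lemma finite_base_times: "finite base_times"
proof (rule finite_subset)
  let ?S = "(\<lambda>(c, m). of_int c / real m) ` ({1..int (p + q)} \<times> {p, q, p + q})"
  show "base_times \<subseteq> ?S"
  proof
    fix t assume "t \<in> base_times"
    then obtain m where m: "m \<in> {p, q, p + q}" "real m * t \<in> \<int>" "0 < t" "t < 1"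
      unfolding base_times_def by blast
    then have "0 < m" using p_pos q_pos by auto
    from multiple_cases[OF m(2-4) this] obtain c
      where "1 \<le> c" "c \<le> int m - 1" "t = of_int c / real m" .
    then show "t \<in> ?S" using m(1) by (intro image_eqI[of _ _ "(c, m)"]) auto
  qed
qed auto

lemma set_base_list [simp]: "set base_list = base_times"
  by (simp add: base_list_def finite_base_times)

lemma sorted_base_list: "sorted_wrt (<) base_list"
  by (simp add: base_list_def strict_sorted_list_of_set)

lemma first_base_time: "1 / real (p + q) \<in> base_times"
proof -
  have "1 / real (p + q) < 1" using p_pos q_pos by (simp add: field_simps)
  moreover have "real (p + q) * (1 / real (p + q)) = 1" using p_pos by simp
  ultimately show ?thesis
    using p_pos by (auto simp only: base_times_def intro!: bexI[of _ "p + q"]) auto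
qed

lemma base_list_neq_Nil: "base_list \<noteq> []"
  using first_base_time set_base_list by fastforce

lemma hd_base_list: "hd base_list = 1 / real (p + q)"
proof (rule antisym)
  have "hd base_list \<in> base_times"
    using base_list_neq_Nil set_base_list hd_in_set by blast
  then show "1 / real (p + q) \<le> hd base_list" by (rule base_bounds)
  obtain x xs where xs: "base_list = x # xs"
    using base_list_neq_Nil by (metis list.exhaust)
  have "1 / real (p + q) \<in> set (x # xs)"
    unfolding xs[symmetric] using first_base_time by simp
  then show "hd base_list \<le> 1 / real (p + q)"
    using sorted_base_list unfolding xs by auto
qed

text \<open>The point would be a lattice point strictly inside the segment, against
  coprimality.\<close>

lemma base_times_not_both:
  assumes "0 < t" "t < 1"
  shows "\<not> (real q * t \<in> \<int> \<and> real p * t \<in> \<int>)"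
proof
  assume a: "real q * t \<in> \<int> \<and> real p * t \<in> \<int>"
  obtain c where c: "1 \<le> c" "c \<le> int p - 1" "t = of_int c / real p"
    using multiple_cases[of p t] a assms p_pos by blast
  obtain d where d: "1 \<le> d" "d \<le> int q - 1" "t = of_int d / real q"
    using multiple_cases[of q t] a assms q_pos by blast
  have "of_int (c * int q) = (of_int (d * int p) :: real)"
    using c(3) d(3) p_pos q_pos by (simp add: field_simps)
  then have "c * int q = d * int p" by (simp only: of_int_eq_iff)
  then have "int p dvd c * int q" by simp
  then have "int p dvd c" using coprime_pq by (simp add: coprime_dvd_mult_left_iff)
  then show False using c(1,2) zdvd_imp_le[of "int p" c] by linarith
qed

lemma base_cases:
  assumes "t \<in> base_times"
  obtains
    (horizontal) a b where "real p * t = of_int b" "of_int a < real q * t" "real q * t < of_int a + 1"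
  | (vertical) a b where "real q * t = of_int a" "of_int b < real p * t" "real p * t < of_int b + 1"
      "real p * t \<notin> \<int>"
  | (diagonal) a b where "real (p + q) * t = of_int (a + b)"
      "of_int a < real q * t" "real q * t < of_int a + 1" "real p * t \<notin> \<int>" "real q * t \<notin> \<int>"
proof -
  have t: "0 < t" "t < 1" "real p * t \<in> \<int> \<or> real q * t \<in> \<int> \<or> real (p + q) * t \<in> \<int>"
    using assms by (auto simp: base_times_def)
  have ex: "\<exists>A B. crosses (line 0 t) A B"
    unfolding ex_crosses_iff using base_times_not_both[OF t(1,2)] t(3)
    by (auto simp: algebra_simps)
  then obtain A B where "crosses (line 0 t) A B" by blast
  then show thesis
  proof (cases rule: crosses_cases)
    case (horizontal a b)
    then show thesis using that(1)[of b a] by (simp add: mult.commute)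
  next
    case (vertical a b)
    then show thesis using that(2)[of a b] strictly_between_not_Ints[of b "real p * t"]
      by (simp add: mult.commute)
  next
    case (diagonal a b)
    have "real p * t \<notin> \<int>"
      by (rule strictly_between_not_Ints[of "b - 1"]) (use diagonal in \<open>simp_all add: algebra_simps\<close>)
    then show thesis using diagonal that(3)[of a b] strictly_between_not_Ints[of a "real q * t"]
      by (simp add: algebra_simps)
  qed
qed

text \<open>The line through \<open>z\<close> crosses the segment that the line through \<open>0\<close> crosses at time \<open>t\<close> at the
  time \<open>shift z t\<close>.\<close>

definition shift :: "complex \<Rightarrow> real \<Rightarrow> real" where
  "shift z t =
     (if real p * t \<in> \<int> then t - Im z / real p
      else if real q * t \<in> \<int> then t - Re z / real q
      else t - (Re z + Im z) / real (p + q))"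

lemma shift_0 [simp]: "shift 0 t = t"
  by (simp add: shift_def)

text \<open>A pair (m, y) stands for the function y + m t, which is Im, Re or Re + Im along
  \<open>line z\<close>.\<close>

definition forms :: "complex \<Rightarrow> (nat \<times> real) set" where
  "forms z = {(p, Im z), (q, Re z), (p + q, Re z + Im z)}"

lemma forms_pos: "(m, y) \<in> forms z \<Longrightarrow> 0 < m"
  using p_pos q_pos by (auto simp: forms_def)

text \<open>Strictly between the times 0 and 1 only one of p t, q t, (p + q) t can be an integer, so
  the case distinction in \<open>shift\<close> has disjoint branches.\<close>

lemma shift_eq:
  assumes "0 < t" "t < 1" "(m, y) \<in> forms z" "real m * t \<in> \<int>"
  shows "shift z t = t - y / real m"
proof -
  have "\<not> (real q * t \<in> \<int> \<and> real p * t \<in> \<int>)" using assms by (intro base_times_not_both)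
  moreover have "real (p + q) * t \<in> \<int> \<Longrightarrow> real p * t \<in> \<int> \<Longrightarrow> real q * t \<in> \<int>"
    using Ints_diff[of "real (p + q) * t" "real p * t"] by (simp add: algebra_simps)
  moreover have "real (p + q) * t \<in> \<int> \<Longrightarrow> real q * t \<in> \<int> \<Longrightarrow> real p * t \<in> \<int>"
    using Ints_diff[of "real (p + q) * t" "real q * t"] by (simp add: algebra_simps)
  ultimately show ?thesis
    using assms(3,4) unfolding forms_def shift_def by auto
qed

lemma base_form:
  assumes "t \<in> base_times"
  obtains m y where "(m, y) \<in> forms z" "real m * t \<in> \<int>" "shift z t = t - y / real m"
proof -
  obtain m where m: "m \<in> {p, q, p + q}" "real m * t \<in> \<int>" "0 < t" "t < 1"
    using assms unfolding base_times_def by blast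
  then obtain y where "(m, y) \<in> forms z" by (auto simp: forms_def)
  then show thesis using m shift_eq that by blast
qed

text \<open>Multiplied by m m', the gap between the old times is a positive integer, hence at least
  1, while the two shifts together contribute 0 or the height of \<open>z\<close> up to sign. With
  t' = 1 the same estimate places \<open>last_times\<close> after all shifted times.\<close>

lemma shift_less:
  assumes "(m, y) \<in> forms z" "(m', y') \<in> forms z" "real m * t \<in> \<int>" "real m' * t' \<in> \<int>"
    and "t < t'" "\<bar>height v z\<bar> < 1"
  shows "t - y / real m < t' - y' / real m'"
proof -
  have pos: "0 < m" "0 < m'" using assms(1,2) forms_pos by blast+
  obtain c c' where c: "real m * t = of_int c" "real m' * t' = of_int c'"
    using assms(3,4) by (auto elim!: Ints_cases)
  have mm: "real m * real m' > 0" using pos by simp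
  have eq: "real m * real m' * (t' - t) = real m * of_int c' - real m' * of_int c"
    unfolding c[symmetric] by (simp add: algebra_simps)
  moreover have "real m * real m' * (t' - t) > 0" using mm assms(5) by simp
  ultimately have "of_int (int m * c' - int m' * c) > (0 :: real)" by simp
  then have "int m * c' - int m' * c \<ge> 1" by linarith
  then have "of_int (int m * c' - int m' * c) \<ge> (1 :: real)" by linarith
  then have "real m * real m' * (t' - t) \<ge> 1" unfolding eq by simp
  moreover have "real m * y' - real m' * y < 1"
    using assms(1,2,6) unfolding forms_def height_v by (auto simp: algebra_simps)
  ultimately have "real m * real m' * (t' - t) > real m * y' - real m' * y" by linarith
  then have "real m * real m' * (t - y / real m) < real m * real m' * (t' - y' / real m')"
    using pos by (simp add: algebra_simps)
  then show ?thesis using mm by (simp only: mult_less_cancel_left_pos)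
qed

text \<open>The segment is the same for every \<open>z\<close>: the crossing point slides along it
  by the height divided by m, with m the coefficient of the form that is integral there, and
  \<open>perturb_between\<close> keeps it off the endpoints.\<close>

lemma crosses_shift:
  assumes "t \<in> base_times"
  obtains A B where "\<And>z. \<bar>height v z\<bar> < 1 / 2 \<Longrightarrow> crosses (line z (shift z t)) A B"
  using assms
proof (cases rule: base_cases)
  case (horizontal a b)
  show thesis
  proof (rule that)
    fix z assume h: "\<bar>height v z\<bar> < 1 / 2"
    have sh: "shift z t = t - Im z / real p"
      unfolding shift_def using horizontal(1) by simp
    have "real p * (real q * t) = of_int (int q * b)"
      using horizontal(1) by (simp add: algebra_simps)
    then have "real p * (real q * t) \<in> \<int>" by (simp only: Ints_of_int)
    then have "of_int a < real q * t + (- height v z) / real p"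
      "real q * t + (- height v z) / real p < of_int a + 1"
      using perturb_between[of a "real q * t" "real p" "- height v z"] horizontal(2,3) h p_pos by auto
    moreover have "Re (line z (shift z t)) = real q * t + (- height v z) / real p"
      "Im (line z (shift z t)) = of_int b"
      unfolding sh using p_pos horizontal(1) by (simp_all add: height_v field_simps)
    ultimately show "crosses (line z (shift z t)) (lattice_point a b) (lattice_point (a + 1) b)"
      by (intro crosses_horizontal) simp_all
  qed
next
  case (vertical a b)
  show thesis
  proof (rule that)
    fix z assume h: "\<bar>height v z\<bar> < 1 / 2"
    have sh: "shift z t = t - Re z / real q"
      unfolding shift_def using vertical(1,4) by simp
    have "real q * (real p * t) = of_int (int p * a)"
      using vertical(1) by (simp add: algebra_simps)
    then have "real q * (real p * t) \<in> \<int>" by (simp only: Ints_of_int)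
    then have "of_int b < real p * t + height v z / real q"
      "real p * t + height v z / real q < of_int b + 1"
      using perturb_between[of b "real p * t" "real q" "height v z"] vertical(2,3) h q_pos by auto
    moreover have "Im (line z (shift z t)) = real p * t + height v z / real q"
      "Re (line z (shift z t)) = of_int a"
      unfolding sh using q_pos vertical(1) by (simp_all add: height_v field_simps)
    ultimately show "crosses (line z (shift z t)) (lattice_point a b) (lattice_point a (b + 1))"
      by (intro crosses_vertical) simp_all
  qed
next
  case (diagonal a b)
  show thesis
  proof (rule that)
    fix z assume h: "\<bar>height v z\<bar> < 1 / 2"
    have sh: "shift z t = t - (Re z + Im z) / real (p + q)"
      unfolding shift_def using diagonal(4,5) by simp
    have "real (p + q) * (real q * t) = real q * (real (p + q) * t)" by simp
    also have "\<dots> = of_int (int q * (a + b))" unfolding diagonal(1) by simp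
    finally have "real (p + q) * (real q * t) = of_int (int q * (a + b))" .
    then have "real (p + q) * (real q * t) \<in> \<int>" by (simp only: Ints_of_int)
    then have "of_int a < real q * t + (- height v z) / real (p + q)"
      "real q * t + (- height v z) / real (p + q) < of_int a + 1"
      using perturb_between[of a "real q * t" "real (p + q)" "- height v z"] diagonal(2,3) h p_pos
      by auto
    moreover have "Re (line z (shift z t)) = real q * t + (- height v z) / real (p + q)"
      unfolding sh using p_pos by (simp add: height_v field_simps)
    moreover have "real (p + q) * shift z t = real (p + q) * t - (Re z + Im z)"
      unfolding sh using p_pos by (simp add: right_diff_distrib)
    then have "Re (line z (shift z t)) + Im (line z (shift z t)) = of_int (a + b)"
      using diagonal(1) by (simp add: algebra_simps)
    ultimately show
      "crosses (line z (shift z t)) (lattice_point a b) (lattice_point (a + 1) (b - 1))"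
      by (intro crosses_diagonal) simp_all
  qed
qed

section \<open>The edges met by the straight segment and their symmetry\<close>

definition base_edges :: "complex set list" where
  "base_edges = map (ends_at (line 0)) base_list"

definition base_signs :: "pm \<Rightarrow> pm list" where
  "base_signs s = edge_signs s v 0 base_edges"

lemma ends_at_shift:
  assumes "t \<in> base_times" "\<bar>height v z\<bar> < 1 / 2"
  shows "ends_at (line z) (shift z t) = ends_at (line 0) t"
    and "\<exists>A B. crosses (line z (shift z t)) A B"
proof -
  obtain A B where AB: "\<And>z. \<bar>height v z\<bar> < 1 / 2 \<Longrightarrow> crosses (line z (shift z t)) A B"
    using crosses_shift[OF assms(1)] by blast
  then show "ends_at (line z) (shift z t) = ends_at (line 0) t"
    using AB[OF assms(2)] AB[of 0] ends_at_eq[of "line z" "shift z t" A B]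
      ends_at_eq[of "line 0" t A B] by simp
  show "\<exists>A B. crosses (line z (shift z t)) A B" using AB[OF assms(2)] by blast
qed

text \<open>The crossing point has height 0 and lies strictly between endpoints of different
  heights, so neither of these is 0.\<close>

lemma height_base_edges:
  assumes "E \<in> set base_edges" "P \<in> E"
  shows "height v P \<in> \<int> - {0}"
proof -
  obtain t where t: "t \<in> base_times" "E = ends_at (line 0) t"
    using assms(1) by (auto simp: base_edges_def)
  obtain A B where AB: "crosses (line 0 t) A B"
    using ends_at_shift(2)[OF t(1), of 0] by auto
  obtain u where u: "0 < u" "u < 1" "line 0 t = (1 - u) *\<^sub>R A + u *\<^sub>R B"
    using AB unfolding crosses_def in_segment by auto
  have "(1 - u) * height v A + u * height v B = height v (line 0 t)"
    unfolding u(3) by simp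
  then have "(1 - u) * height v A + u * height v B = 0" by simp
  then have "height v A \<noteq> 0" "height v B \<noteq> 0"
    using u(1,2) crosses_height(1)[OF AB] by auto
  then show ?thesis
    using assms(2) crosses_height(2,3)[OF AB] t(2) ends_at_eq[of "line 0" t, OF AB] by auto
qed

lemma inner_signs_line:
  assumes "\<And>t. t \<in> set ts \<Longrightarrow> \<exists>A B. crosses (line z t) A B"
  shows "inner_signs s (line z) ts = edge_signs s v (height v z) (map (ends_at (line z)) ts)"
  by (rule inner_signs_straight) (use assms crosses_height(1) vector_derivative_line in \<open>fastforce\<close>)

text \<open>Between consecutive crossings the line runs through a triangle, and the two segments are sides
  of it.\<close>

lemma consecutive_edges:
  assumes t: "t \<in> base_times" "t' \<in> base_times" "t < t'" and "{t<..<t'} \<inter> base_times = {}"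
  shows "\<exists>P. ends_at (line 0) t \<inter> ends_at (line 0) t' = {P} \<and> height v P \<noteq> 0"
proof -
  define m where "m = (t + t') / 2"
  have m: "t < m" "m < t'" using t(3) by (auto simp: m_def)
  have t01: "0 < t" "t' < 1" using t by (auto simp: base_times_def)
  \<comment> \<open>No form takes an integer value strictly between the two times, so on the closed
    interval each stays between the two integers that its value at the midpoint \<open>m\<close>
    singles out.\<close>
  have fl: "of_int \<lfloor>real c * m\<rfloor> \<le> real c * t" "real c * t' \<le> of_int \<lfloor>real c * m\<rfloor> + 1"
    if c: "c \<in> {p, q, p + q}" for c
  proof -
    have c0: "0 < c" using c p_pos q_pos by auto
    have no: "\<not> (t < u \<and> u < t' \<and> real c * u \<in> \<int>)" for u
    proof
      assume u: "t < u \<and> u < t' \<and> real c * u \<in> \<int>"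
      then have "u \<in> base_times" using c t01 unfolding base_times_def by (auto intro!: bexI[of _ c])
      then show False using assms(4) u by auto
    qed
    show "of_int \<lfloor>real c * m\<rfloor> \<le> real c * t"
    proof (rule ccontr)
      assume a: "\<not> of_int \<lfloor>real c * m\<rfloor> \<le> real c * t"
      have "of_int \<lfloor>real c * m\<rfloor> \<le> real c * m" by simp
      then have "of_int \<lfloor>real c * m\<rfloor> / real c \<le> m" using c0 by (simp add: field_simps)
      moreover have "t < of_int \<lfloor>real c * m\<rfloor> / real c" using a c0 by (simp add: field_simps)
      moreover have "real c * (of_int \<lfloor>real c * m\<rfloor> / real c) \<in> \<int>" using c0 by simp
      ultimately show False using no m(2) by (meson le_less_trans)
    qed
    show "real c * t' \<le> of_int \<lfloor>real c * m\<rfloor> + 1"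
    proof (rule ccontr)
      assume a: "\<not> real c * t' \<le> of_int \<lfloor>real c * m\<rfloor> + 1"
      have "real c * m < of_int \<lfloor>real c * m\<rfloor> + 1" by linarith
      then have "m < (of_int \<lfloor>real c * m\<rfloor> + 1) / real c" using c0 by (simp add: field_simps)
      moreover have "real c * ((of_int \<lfloor>real c * m\<rfloor> + 1) / real c) = of_int (\<lfloor>real c * m\<rfloor> + 1)"
        using c0 by simp
      then have "real c * ((of_int \<lfloor>real c * m\<rfloor> + 1) / real c) \<in> \<int>" by (simp only: Ints_of_int)
      moreover have "(of_int \<lfloor>real c * m\<rfloor> + 1) / real c < t'" using a c0 by (simp add: field_simps)
      ultimately show False using no m(1) by (meson less_trans)
    qed
  qed
  define X Y S where XYS: "X = \<lfloor>real q * m\<rfloor>" "Y = \<lfloor>real p * m\<rfloor>" "S = \<lfloor>real (p + q) * m\<rfloor>"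
  have bd: "of_int X \<le> real q * t" "real q * t' \<le> of_int X + 1"
    "of_int Y \<le> real p * t" "real p * t' \<le> of_int Y + 1"
    "of_int S \<le> real q * t + real p * t" "real q * t' + real p * t' \<le> of_int S + 1"
    using fl[of q] fl[of p] fl[of "p + q"] by (simp_all add: XYS algebra_simps)
  have lt: "real q * t < real q * t'" "real p * t < real p * t'"
    using t(3) p_pos q_pos by simp_all
  have int: "real q * u \<in> \<int> \<or> real p * u \<in> \<int> \<or> real q * u + real p * u \<in> \<int>"
    "\<not> (real q * u \<in> \<int> \<and> real p * u \<in> \<int>)" if "u \<in> base_times" for u
    using that base_times_not_both[of u] by (auto simp: base_times_def algebra_simps)
  have lo: "x = of_int i" if "x \<in> \<int>" "of_int i \<le> x" "x < of_int i + 1" for x :: real and i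
    using that by (auto elim!: Ints_cases)
  have hi: "x = of_int i + 1" if "x \<in> \<int>" "of_int i < x" "x \<le> of_int i + 1" for x :: real and i
    using that by (auto elim!: Ints_cases)
  \<comment> \<open>The two cases are the lower left and the upper right triangle of the unit square
    with corner (X, Y).\<close>
  have "S = X + Y \<or> S = X + Y + 1"
    unfolding XYS by (simp add: algebra_simps) linarith
  then obtain A B C D where AB: "crosses (line 0 t) A B" and CD: "crosses (line 0 t') C D"
    and ABCD: "\<exists>P. {A, B} \<inter> {C, D} = {P}"
  proof (elim disjE)
    \<comment> \<open>As the slope is positive, the line enters the lower triangle through its left
      or bottom side and leaves it through the diagonal.\<close>
    assume S: "S = X + Y"
    have t': "real q * t' + real p * t' = of_int (X + (Y + 1))" "real q * t' < of_int X + 1"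
      using int[OF t(2)] hi[of "real q * t'" X] hi[of "real p * t'" Y]
        hi[of "real q * t' + real p * t'" S] bd lt S by (auto simp: algebra_simps)
    have CD: "crosses (line 0 t') (lattice_point X (Y + 1)) (lattice_point (X + 1) (Y + 1 - 1))"
      by (rule crosses_diagonal) (use t' bd lt in \<open>simp_all add: algebra_simps\<close>)
    consider "real q * t = of_int X" "real p * t \<noteq> of_int Y"
      | "real p * t = of_int Y" "real q * t \<noteq> of_int X"
    proof -
      have "real q * t \<in> \<int> \<Longrightarrow> real q * t = of_int X" "real p * t \<in> \<int> \<Longrightarrow> real p * t = of_int Y"
        using lo[of "real q * t" X] lo[of "real p * t" Y] bd lt by linarith+
      moreover have "real q * t + real p * t \<in> \<int> \<Longrightarrow> real q * t + real p * t = of_int X + of_int Y"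
        using lo[of "real q * t + real p * t" S] bd lt S by simp
      then have "real q * t + real p * t \<in> \<int> \<Longrightarrow> real q * t = of_int X \<and> real p * t = of_int Y"
        using bd by linarith
      moreover have "\<not> (real q * t = of_int X \<and> real p * t = of_int Y)" using int(2)[OF t(1)] by auto
      ultimately show thesis using int(1)[OF t(1)] that by blast
    qed
    then show thesis
    proof cases
      case 1
      have "crosses (line 0 t) (lattice_point X Y) (lattice_point X (Y + 1))"
        by (rule crosses_vertical) (use 1 bd lt in \<open>simp_all add: algebra_simps\<close>)
      then show thesis using CD by (rule that) auto
    next
      case 2
      have "crosses (line 0 t) (lattice_point X Y) (lattice_point (X + 1) Y)"
        by (rule crosses_horizontal) (use 2 bd lt in \<open>simp_all add: algebra_simps\<close>)
      then show thesis using CD by (rule that) auto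
    qed
  next
    \<comment> \<open>The upper triangle is entered through the diagonal and left through its right
      or top side.\<close>
    assume S: "S = X + Y + 1"
    have t': "real q * t + real p * t = of_int (X + (Y + 1))" "of_int X < real q * t"
      using int[OF t(1)] lo[of "real q * t" X] lo[of "real p * t" Y]
        lo[of "real q * t + real p * t" S] bd lt S by (auto simp: algebra_simps)
    have AB: "crosses (line 0 t) (lattice_point X (Y + 1)) (lattice_point (X + 1) (Y + 1 - 1))"
      by (rule crosses_diagonal) (use t' bd lt in \<open>simp_all add: algebra_simps\<close>)
    consider "real q * t' = of_int X + 1" "real p * t' \<noteq> of_int Y + 1"
      | "real p * t' = of_int Y + 1" "real q * t' \<noteq> of_int X + 1"
    proof -
      have "real q * t' \<in> \<int> \<Longrightarrow> real q * t' = of_int X + 1"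
        "real p * t' \<in> \<int> \<Longrightarrow> real p * t' = of_int Y + 1"
        using hi[of "real q * t'" X] hi[of "real p * t'" Y] bd lt by linarith+
      moreover have "real q * t' + real p * t' \<in> \<int> \<Longrightarrow>
          real q * t' + real p * t' = of_int X + 1 + (of_int Y + 1)"
        using hi[of "real q * t' + real p * t'" S] bd lt S by simp
      then have "real q * t' + real p * t' \<in> \<int> \<Longrightarrow>
          real q * t' = of_int X + 1 \<and> real p * t' = of_int Y + 1"
        using bd by linarith
      moreover have "\<not> (real q * t' = of_int X + 1 \<and> real p * t' = of_int Y + 1)"
        using int(2)[OF t(2)] by auto
      ultimately show thesis using int(1)[OF t(2)] that by blast
    qed
    then show thesis
    proof cases
      case 1
      have "crosses (line 0 t') (lattice_point (X + 1) Y) (lattice_point (X + 1) (Y + 1))"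
        by (rule crosses_vertical) (use 1 bd lt in \<open>simp_all add: algebra_simps\<close>)
      then show thesis by (rule that[OF AB]) auto
    next
      case 2
      have "crosses (line 0 t') (lattice_point X (Y + 1)) (lattice_point (X + 1) (Y + 1))"
        by (rule crosses_horizontal) (use 2 bd lt in \<open>simp_all add: algebra_simps\<close>)
      then show thesis by (rule that[OF AB]) auto
    qed
  qed
  then have "\<exists>P. ends_at (line 0) t \<inter> ends_at (line 0) t' = {P}"
    by (simp add: ends_at_eq[of "line 0", OF AB] ends_at_eq[of "line 0", OF CD])
  then obtain P where P: "ends_at (line 0) t \<inter> ends_at (line 0) t' = {P}" by blast
  moreover have "height v P \<in> \<int> - {0}"
    by (rule height_base_edges[of "ends_at (line 0) t"]) (use P t(1) in \<open>auto simp: base_edges_def\<close>)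
  ultimately show ?thesis by blast
qed

lemma reflect_base_list: "map ((-) 1) (rev base_list) = base_list"
proof (rule strict_sorted_equal)
  have "1 - t \<in> base_times" if t: "t \<in> base_times" for t
  proof -
    obtain m where m: "m \<in> {p, q, p + q}" "real m * t \<in> \<int>" "0 < t" "t < 1"
      using t unfolding base_times_def by blast
    have "real m * (1 - t) = of_int (int m) - real m * t" by (simp add: algebra_simps)
    also have "\<dots> \<in> \<int>" using m(2) by (intro Ints_diff Ints_of_int)
    finally show ?thesis using m unfolding base_times_def by auto
  qed
  then have "(-) 1 ` base_times = base_times"
    by (auto intro!: image_eqI[of _ "(-) 1" "1 - _"])
  then show "set (map ((-) 1) (rev base_list)) = set base_list" by simp
  show "sorted_wrt (<) (map ((-) 1) (rev base_list))"
    using sorted_base_list by (simp add: sorted_wrt_map sorted_wrt_rev)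
qed (fact sorted_base_list)

text \<open>The point reflection at v/2 preserves the lattice and exchanges the times t and 1 -
  t.\<close>

lemma base_edges_reflect: "base_edges = rev (map ((`) ((-) v)) base_edges)"
proof -
  have "ends_at (line 0) (1 - t) = (-) v ` ends_at (line 0) t" if t: "t \<in> base_times" for t
  proof -
    obtain A B where AB: "crosses (line 0 t) A B"
      using ends_at_shift(2)[OF t, of 0] by auto
    have "line 0 (1 - t) = v - line 0 t" by (simp add: line_def algebra_simps)
    then have "crosses (line 0 (1 - t)) (v - B) (v - A)"
      using crosses_reflect[OF AB] by (simp add: v_def)
    from ends_at_eq[of "line 0", OF this] ends_at_eq[of "line 0", OF AB] show ?thesis by auto
  qed
  then have "map (ends_at (line 0)) (map ((-) 1) (rev base_list)) =
      rev (map ((`) ((-) v)) base_edges)"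
    by (simp add: base_edges_def rev_map)
  then show ?thesis
    unfolding reflect_base_list base_edges_def .
qed

lemma successively_base_edges:
  "successively (\<lambda>E F. \<exists>P. E \<inter> F = {P} \<and> height v P \<noteq> 0) base_edges"
proof -
  have "\<exists>P. ends_at (line 0) (base_list ! i) \<inter> ends_at (line 0) (base_list ! Suc i) = {P} \<and> height v P \<noteq> 0"
    if i: "Suc i < length base_list" for i
  proof (rule consecutive_edges)
    show "base_list ! i \<in> base_times" "base_list ! Suc i \<in> base_times"
      using i by (simp_all flip: set_base_list)
    show "base_list ! i < base_list ! Suc i"
      using sorted_base_list i by (simp add: sorted_wrt_nth_less)
    show "{base_list ! i<..<base_list ! Suc i} \<inter> base_times = {}"
    proof (rule equals0I)
      fix t assume t: "t \<in> {base_list ! i<..<base_list ! Suc i} \<inter> base_times"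
      then obtain j where j: "j < length base_list" "t = base_list ! j"
        by (metis IntD2 in_set_conv_nth set_base_list)
      have "\<not> j \<le> i" "\<not> Suc i \<le> j"
        using t j i sorted_nth_mono[OF strict_sorted_imp_sorted[OF sorted_base_list], of j i]
          sorted_nth_mono[OF strict_sorted_imp_sorted[OF sorted_base_list], of "Suc i" j] by auto
      then show False by simp
    qed
  qed
  then show ?thesis
    by (simp add: base_edges_def successively_map successively_conv_nth)
qed

lemma base_signs_flip: "base_signs (flip_sign s) = rev (map flip_sign (base_signs s))"
  unfolding base_signs_def
  by (subst base_edges_reflect) (rule edge_signs_reflect[OF _ successively_base_edges], simp)

text \<open>Together with its mirror image \<open>last_base_edges\<close> this fixes the corners
  where a turn begins and ends.\<close>

lemma hd_base_edges: "hd base_edges = {lattice_point 0 1, lattice_point 1 0}"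
proof -
  have "crosses (line 0 (1 / real (p + q))) (lattice_point 0 1) (lattice_point (0 + 1) (1 - 1))"
  proof -
    have "0 < real p + real q" using p_pos by simp
    then show ?thesis
      using q_pos p_pos by (intro crosses_diagonal) (simp_all add: divide_simps)
  qed
  from ends_at_eq[of "line 0", OF this] show ?thesis
    by (simp add: base_edges_def hd_map base_list_neq_Nil hd_base_list)
qed

lemma last_base_edges:
  "last base_edges = {lattice_point (int q - 1) (int p), lattice_point (int q) (int p - 1)}"
proof -
  have "base_edges \<noteq> []" by (simp add: base_edges_def base_list_neq_Nil)
  then have "last base_edges = (-) v ` hd base_edges"
    by (subst base_edges_reflect) (simp add: last_rev hd_map)
  then show ?thesis
    by (simp add: hd_base_edges v_def lattice_point_diff insert_commute)
qed

text \<open>The fan at (q, p). A line that passes on the left meets the segments to the west,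
  north-west and north, one that passes on the right those to the south, south-east and east. In
  both cases these are the times at which Im is p, Re + Im is p + q and Re is q; only their order
  depends on the side.\<close>

definition last_times :: "complex \<Rightarrow> real list" where
  "last_times z =
     (let ts = [1 - Im z / real p, 1 - (Re z + Im z) / real (p + q), 1 - Re z / real q]
      in if 0 < height v z then ts else rev ts)"

lemma set_last_times: "set (last_times z) = (\<lambda>(m, y). 1 - y / real m) ` forms z"
  by (auto simp: last_times_def forms_def Let_def)

text \<open>Inside the fan the order is the mediant inequality for Re z / q and Im z / p, whose
  direction is the sign of the height; the rest is \<open>shift_less\<close>.\<close>

lemma sorted_nudged_times:
  assumes h: "height v z \<noteq> 0" "\<bar>height v z\<bar> < 1 / 2"
  shows "sorted_wrt (<) (map (shift z) base_list @ last_times z)"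
proof -
  have shift: "shift z t < shift z t'" if tt: "t \<in> base_times" "t' \<in> base_times" "t < t'" for t t'
  proof -
    obtain m y where m: "(m, y) \<in> forms z" "real m * t \<in> \<int>" "shift z t = t - y / real m"
      using base_form[OF tt(1)] .
    obtain m' y' where m': "(m', y') \<in> forms z" "real m' * t' \<in> \<int>" "shift z t' = t' - y' / real m'"
      using base_form[OF tt(2)] .
    show ?thesis unfolding m(3) m'(3)
      by (rule shift_less[OF m(1) m'(1) m(2) m'(2) tt(3)]) (use h(2) in simp)
  qed
  have last: "shift z t < t'" if tt: "t \<in> base_times" "t' \<in> set (last_times z)" for t t'
  proof -
    obtain m y where m: "(m, y) \<in> forms z" "real m * t \<in> \<int>" "shift z t = t - y / real m"
      using base_form[OF tt(1)] .
    obtain m' y' where m': "(m', y') \<in> forms z" "t' = 1 - y' / real m'"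
      using tt(2) unfolding set_last_times by auto
    show ?thesis unfolding m(3) m'(2)
      by (rule shift_less[OF m(1) m'(1) m(2)]) (use tt(1) h(2) in \<open>auto simp: base_times_def\<close>)
  qed
  have "sorted_wrt (<) (last_times z)"
  proof (cases "0 < height v z")
    case True
    then have "Re z / real q < (Re z + Im z) / real (p + q)"
      "(Re z + Im z) / real (p + q) < Im z / real p"
      using p_pos q_pos by (simp_all add: height_v field_simps)
    then show ?thesis using True by (simp add: last_times_def Let_def)
  next
    case False
    then have "height v z < 0" using h(1) by simp
    then have "Im z / real p < (Re z + Im z) / real (p + q)"
      "(Re z + Im z) / real (p + q) < Re z / real q"
      using p_pos q_pos by (simp_all add: height_v field_simps)
    then show ?thesis using False by (simp add: last_times_def Let_def)
  qed
  then show ?thesis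
    using sorted_base_list shift last
    by (auto simp: sorted_wrt_append sorted_wrt_map intro: sorted_wrt_mono_rel[rotated])
qed

text \<open>Each form starts strictly between 0 and 1, so the integers it reaches at times in (0, 1)
  are 1 to m. Those below m give the shifted times and m gives the fan at (q, p); the fan at the
  origin lies in the past. A height that is not an integer keeps the line off the lattice
  points.\<close>

lemma set_nudged_times:
  assumes z: "0 < Re z" "0 < Im z" "Re z + Im z < 1" and h: "height v z \<noteq> 0" "\<bar>height v z\<bar> < 1 / 2"
  shows "set (map (shift z) base_list @ last_times z) = {t \<in> {0<..<1}. \<exists>A B. crosses (line z t) A B}"
proof -
  have forms_z: "0 < y \<and> y < 1 \<and> 0 < m" if "(m, y) \<in> forms z" for m y
    using that z p_pos q_pos by (auto simp: forms_def)
  have crossing: "(\<exists>A B. crosses (line z t) A B) \<longleftrightarrow> (\<exists>(m, y) \<in> forms z. y + real m * t \<in> \<int>)" for t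
  proof -
    have "\<not> (Re (line z t) \<in> \<int> \<and> Im (line z t) \<in> \<int>)"
    proof
      assume "Re (line z t) \<in> \<int> \<and> Im (line z t) \<in> \<int>"
      then have "height v (line z t) \<in> \<int>" by (simp add: height_v)
      then have "height v z \<in> \<int>" by (simp only: height_line)
      then show False using h by (auto elim!: Ints_cases)
    qed
    then show ?thesis
      unfolding ex_crosses_iff forms_def by (auto simp: algebra_simps)
  qed
  show ?thesis
  proof (intro equalityI subsetI)
    fix t assume "t \<in> set (map (shift z) base_list @ last_times z)"
    then consider u where "u \<in> base_times" "t = shift z u" | "t \<in> set (last_times z)" by auto
    then show "t \<in> {t \<in> {0<..<1}. \<exists>A B. crosses (line z t) A B}"
    proof cases
      case 1
      obtain m y where m: "(m, y) \<in> forms z" "real m * u \<in> \<int>" "shift z u = u - y / real m"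
        using base_form[OF 1(1)] .
      note y = forms_z[OF m(1)]
      have u: "0 < u" "u < 1" using 1(1) by (auto simp: base_times_def)
      obtain c where c: "1 \<le> c" "c \<le> int m - 1" "u = of_int c / real m"
        using multiple_cases[OF m(2) u] y by blast
      have "t = (of_int c - y) / real m" using 1(2) m(3) c(3) by (simp add: diff_divide_distrib)
      moreover have "0 < of_int c - y" "of_int c - y < real m"
        using c(1,2) y by linarith+
      ultimately have "0 < t" "t < 1" using y by simp_all
      then show ?thesis using ends_at_shift(2)[OF 1(1) h(2)] 1(2) by auto
    next
      case 2
      then obtain m y where m: "(m, y) \<in> forms z" "t = 1 - y / real m"
        unfolding set_last_times by auto
      note y = forms_z[OF m(1)]
      have "1 \<le> real m" using y by simp
      then have "0 < y / real m" "y / real m < 1" using y by (simp_all add: field_simps)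
      then have "0 < t" "t < 1" using m(2) by simp_all
      moreover have "y + real m * t = of_int (int m)" using y m(2) by (simp add: field_simps)
      then have "y + real m * t \<in> \<int>" by (simp only: Ints_of_int)
      ultimately show ?thesis using crossing m(1) by auto
    qed
  next
    fix t assume "t \<in> {t \<in> {0<..<1}. \<exists>A B. crosses (line z t) A B}"
    then obtain m y where t: "0 < t" "t < 1" and m: "(m, y) \<in> forms z" "y + real m * t \<in> \<int>"
      using crossing by auto
    note y = forms_z[OF m(1)]
    obtain c where c: "y + real m * t = of_int c" using m(2) by (auto elim: Ints_cases)
    have "0 < real m * t" "real m * t < real m" using t y by simp_all
    then have "0 < y + real m * t" "y + real m * t < real m + 1" using y by linarith+
    then have "1 \<le> c" "c \<le> int m" unfolding c by linarith+
    have t_eq: "t = of_int c / real m - y / real m" using c y by (simp add: field_simps)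
    show "t \<in> set (map (shift z) base_list @ last_times z)"
    proof (cases "c = int m")
      case True
      then have "t = 1 - y / real m" using t_eq y by simp
      then show ?thesis using m(1) unfolding set_append set_last_times by force
    next
      case False
      define u where "u = of_int c / real m"
      have u: "0 < u" "u < 1" using \<open>1 \<le> c\<close> \<open>c \<le> int m\<close> False y by (simp_all add: u_def)
      have mu: "real m * u \<in> \<int>" using y by (simp add: u_def)
      then have "u \<in> base_times" using m(1) u unfolding base_times_def forms_def by blast
      moreover have "shift z u = u - y / real m"
        by (rule shift_eq[OF u m(1) mu])
      then have "t = shift z u" unfolding t_eq u_def by (rule sym)
      ultimately show ?thesis by auto
    qed
  qed
qed

text \<open>In the fan the three crossings are closest to \<open>v\<close> and the two corners
  between them are at \<open>v\<close>: five equal signs. The corners just before and after the fan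
  lie on the other side. The recurrence of the first crossing is needed for the last of these
  corners.\<close>

lemma cyclic_signs_line:
  assumes z: "0 < Re z" "0 < Im z" "Re z + Im z < 1" and h: "height v z \<noteq> 0" "\<bar>height v z\<bar> < 1 / 2"
  defines "s \<equiv> if 0 < height v z then Plus else Minus"
  shows "cyclic_signs (line z) = base_signs s @ turn_signs s"
proof -
  let ?h = "height v z" and ?v = "lattice_point (int q) (int p)"
  define ts where "ts = map (shift z) base_list @ last_times z"
  have ct: "crossing_times (line z) {0<..<1} = ts"
    unfolding ts_def by (rule crossing_times_eq[OF sorted_nudged_times[OF h] set_nudged_times[OF z h]])
  have hd: "hd ts = shift z (1 / real (p + q))"
    using base_list_neq_Nil hd_base_list by (simp add: ts_def hd_map)
  have "ends_at (line z) (hd ts) = hd base_edges" "\<exists>A B. crosses (line z (hd ts)) A B"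
    unfolding hd using ends_at_shift[OF first_base_time h(2)]
    by (simp_all add: base_edges_def hd_map base_list_neq_Nil hd_base_list)
  then obtain A B where AB: "crosses (line z (hd ts)) A B" "hd base_edges = {A, B}"
    using ends_at_eq[of "line z" "hd ts"] by metis
  have "line z (1 + hd ts) = ?v + line z (hd ts)"
    using line_add[of z "hd ts" 1] by (simp add: add.commute)
  then have next_cross: "crosses (line z (1 + hd ts)) (?v + A) (?v + B)"
    using crosses_translate[OF AB(1)] by simp
  then have "ends_at (line z) (1 + hd ts) = (+) ?v ` hd base_edges"
    using ends_at_eq[of "line z" "1 + hd ts"] AB(2) by simp
  then have next_ends: "ends_at (line z) (1 + hd ts) =
      {lattice_point (int q) (int p + 1), lattice_point (int q + 1) (int p)}"
    by (simp add: hd_base_edges lattice_point_add add.commute)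
  have "\<exists>A B. crosses (line z t) A B" if "t \<in> set (ts @ [1 + hd ts])" for t
  proof -
    have "t \<in> set ts \<or> t = 1 + hd ts" using that by auto
    then show ?thesis
      unfolding ts_def set_nudged_times[OF z h] using next_cross[unfolded ts_def] by auto
  qed
  then have signs: "inner_signs Plus (line z) (ts @ [1 + hd ts]) =
      edge_signs Plus v ?h (map (ends_at (line z)) (ts @ [1 + hd ts]))"
    by (rule inner_signs_line)
  have "map (ends_at (line z)) (map (shift z) base_list) = base_edges"
    using ends_at_shift(1)[OF _ h(2)] by (simp add: base_edges_def)
  then have ends: "map (ends_at (line z)) (ts @ [1 + hd ts]) =
      base_edges @ map (ends_at (line z)) (last_times z @ [1 + hd ts])"
    by (simp add: ts_def)
  have R: "Re (line z (1 - Im z / real p)) = real q - ?h / real p"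
    "Im (line z (1 - Im z / real p)) = real p"
    "Im (line z (1 - Re z / real q)) = real p + ?h / real q"
    "Re (line z (1 - Re z / real q)) = real q"
    "Re (line z (1 - (Re z + Im z) / real (p + q))) = real q - ?h / real (p + q)"
    using p_pos q_pos by (simp_all add: height_v field_simps)
  have "Im (line z (1 - (Re z + Im z) / real (p + q))) = real p + ?h / real (p + q)"
  proof -
    have "real (p + q) * (1 - (Re z + Im z) / real (p + q)) = real (p + q) - (Re z + Im z)"
      using p_pos by (simp add: right_diff_distrib)
    moreover have "Re (line z t) + Im (line z t) = Re z + Im z + real (p + q) * t" for t
      by (simp add: algebra_simps)
    ultimately have "Re (line z (1 - (Re z + Im z) / real (p + q))) +
        Im (line z (1 - (Re z + Im z) / real (p + q))) = real q + real p"
      by (simp only:)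
    then show ?thesis unfolding R by linarith
  qed
  note R = R this
  have small: "0 < ?h \<Longrightarrow> 0 < ?h / real m \<and> ?h / real m < 1"
    "?h < 0 \<Longrightarrow> -1 < ?h / real m \<and> ?h / real m < 0" if "0 < m" for m
  proof -
    have "1 \<le> real m" using that by simp
    then show "0 < ?h \<Longrightarrow> 0 < ?h / real m \<and> ?h / real m < 1"
      "?h < 0 \<Longrightarrow> -1 < ?h / real m \<and> ?h / real m < 0"
      using h(2) by (simp_all add: field_simps)
  qed
  note p = small[OF p_pos] and q = small[OF q_pos] and pq = small[of "p + q", OF add_pos_pos[OF p_pos q_pos]]
  have cross:
    "?h > 0 \<Longrightarrow> crosses (line z (1 - Im z / real p))
       (lattice_point (int q - 1) (int p)) (lattice_point (int q - 1 + 1) (int p))"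
    "?h > 0 \<Longrightarrow> crosses (line z (1 - Re z / real q)) ?v (lattice_point (int q) (int p + 1))"
    "?h > 0 \<Longrightarrow> crosses (line z (1 - (Re z + Im z) / real (p + q)))
       (lattice_point (int q - 1) (int p + 1)) (lattice_point (int q - 1 + 1) (int p + 1 - 1))"
    "?h < 0 \<Longrightarrow> crosses (line z (1 - Im z / real p)) ?v (lattice_point (int q + 1) (int p))"
    "?h < 0 \<Longrightarrow> crosses (line z (1 - Re z / real q))
       (lattice_point (int q) (int p - 1)) (lattice_point (int q) (int p - 1 + 1))"
    "?h < 0 \<Longrightarrow> crosses (line z (1 - (Re z + Im z) / real (p + q)))
       ?v (lattice_point (int q + 1) (int p - 1))"
    using p q pq
    by (intro crosses_horizontal crosses_vertical crosses_diagonal; simp only: R; simp)+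
  note ends_last = cross[THEN ends_at_eq[of "line z"]]
  \<comment> \<open>Moving the line back to height 0 turns its side into the midpoint sign.\<close>
  have base: "edge_signs Plus v ?h base_edges = base_signs s"
    using edge_signs_perturb[OF height_base_edges h(2), where s = Plus] h(1)
    by (auto simp: base_signs_def s_def)
  define Es where "Es = map (ends_at (line z)) (last_times z @ [1 + hd ts])"
  have "edge_signs Plus v ?h (map (ends_at (line z)) (ts @ [1 + hd ts])) =
      base_signs s @ edge_corner_sign v ?h (last base_edges) (hd Es) # edge_signs Plus v ?h Es"
    unfolding ends base[symmetric] Es_def
    by (subst edge_signs_append) (simp_all add: base_edges_def base_list_neq_Nil)
  also have "butlast \<dots> = base_signs s @ turn_signs s"
  proof (cases "?h > 0")
    case True
    have Es: "Es = [{lattice_point (int q - 1) (int p), lattice_point (int q - 1 + 1) (int p)},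
        {lattice_point (int q - 1) (int p + 1), lattice_point (int q - 1 + 1) (int p + 1 - 1)},
        {?v, lattice_point (int q) (int p + 1)},
        {lattice_point (int q) (int p + 1), lattice_point (int q + 1) (int p)}]"
      unfolding Es_def last_times_def Let_def if_P[OF True] list.map append.simps
        ends_last(1-3)[OF True] next_ends ..
    have s: "s = Plus" using True by (simp add: s_def)
    show ?thesis
      unfolding Es s last_base_edges using True h(2) p_pos q_pos
      by (simp add: turn_signs_def butlast_append numeral_eq_Suc
          edge_corner_sign_def edge_sign_def height_lattice_point algebra_simps)
  next
    case False
    then have neg: "?h < 0" using h(1) by simp
    have Es: "Es = [{lattice_point (int q) (int p - 1), lattice_point (int q) (int p - 1 + 1)},
        {?v, lattice_point (int q + 1) (int p - 1)},
        {?v, lattice_point (int q + 1) (int p)},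
        {lattice_point (int q) (int p + 1), lattice_point (int q + 1) (int p)}]"
      unfolding Es_def last_times_def Let_def if_not_P[OF False] list.map append.simps rev.simps
        ends_last(4-6)[OF neg] next_ends ..
    have s: "s = Minus" using False by (simp add: s_def)
    show ?thesis
      unfolding Es s last_base_edges using neg h(2) p_pos q_pos
      by (simp add: turn_signs_def butlast_append numeral_eq_Suc
          edge_corner_sign_def edge_sign_def height_lattice_point algebra_simps)
  qed
  finally show ?thesis
    unfolding cyclic_signs_def ct Let_def signs .
qed

end

section \<open>The path around the lattice points\<close>

locale deformation = slope +
  fixes r :: real
  assumes r_pos: "0 < r" and r_less: "r < 1 / 2"
begin

text \<open>The half-circles take up the times within distance \<open>\<rho>\<close> of an intermediate integer.\<close>

definition \<rho> :: real where "\<rho> = r / norm v"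

text \<open>Polar angle on the half-circle, with \<open>x\<close> the time counted from the integer.
  It decreases from Arg v + pi to Arg v because the half-circle runs clockwise.\<close>

definition angle :: "real \<Rightarrow> real" where
  "angle x = Arg v + pi / 2 * (1 - x / \<rho>)"

definition offset :: "real \<Rightarrow> real" where
  "offset \<beta> = \<rho> * (1 - 2 * (\<beta> - Arg v) / pi)"

lemma v_neq_0: "v \<noteq> 0"
  using q_pos by (auto simp: complex_eq_iff)

lemma rho_pos: "0 < \<rho>"
  using r_pos v_neq_0 by (simp add: \<rho>_def)

text \<open>Since (p + q)/2 is less than the norm of \<open>v\<close>, a radius below 1/2 makes
  every half-circle end before the next straight part has its first crossing.\<close>

lemma rho_less: "\<rho> < 1 / real (p + q)"
proof -
  have "((x + y) / 2)\<^sup>2 < x\<^sup>2 + y\<^sup>2" if "0 < x" for x y :: real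
  proof -
    have "x\<^sup>2 + y\<^sup>2 - ((x + y) / 2)\<^sup>2 = (x\<^sup>2 + (y\<^sup>2 + (x - y)\<^sup>2 / 2)) / 2"
      by (simp add: power2_eq_square field_simps)
    also have "\<dots> > 0" using that by (auto intro!: add_pos_nonneg)
    finally show ?thesis by simp
  qed
  from this[of "real q" "real p"] have "(real (p + q) / 2)\<^sup>2 < (real q)\<^sup>2 + (real p)\<^sup>2"
    using q_pos by (simp add: add.commute)
  then have "real (p + q) / 2 < norm v"
    unfolding cmod_def v_simps by (rule real_less_rsqrt)
  moreover have "r * real (p + q) < 1 / 2 * real (p + q)"
    using r_less p_pos by (intro mult_strict_right_mono) auto
  ultimately have "r * real (p + q) < norm v" by simp
  then show ?thesis
    using p_pos v_neq_0 by (simp add: \<rho>_def field_simps)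
qed

lemma rho_less_half: "\<rho> < 1 / 2"
proof -
  have "1 / real (p + q) \<le> 1 / 2" using p_pos q_pos by (simp add: field_simps)
  then show ?thesis using rho_less by linarith
qed

lemma Arg_v: "0 < Arg v" "Arg v < pi / 2"
  using p_pos q_pos Arg_lt_pi[of v] Arg_Re_pos[of v] by auto

lemma angle_offset [simp]: "angle (offset \<beta>) = \<beta>"
  using rho_pos by (simp add: angle_def offset_def field_simps)

lemma offset_angle [simp]: "offset (angle x) = x"
  using rho_pos by (simp add: angle_def offset_def field_simps)

lemma offset_less_iff: "offset \<beta> < offset \<beta>' \<longleftrightarrow> \<beta>' < \<beta>"
  using rho_pos by (simp add: offset_def field_simps)

text \<open>The half-circle depends on the slope, but as Arg v is acute its angles stay in a range
  that does not.\<close>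

lemma angle_bounds:
  assumes "\<bar>x\<bar> < \<rho>"
  shows "0 < angle x" "angle x < 3 * pi / 2"
proof -
  have "-1 < x / \<rho>" "x / \<rho> < 1" using assms rho_pos by (auto simp: field_simps abs_less_iff)
  then have "0 < 1 - x / \<rho>" "1 - x / \<rho> < 2" by linarith+
  then have "0 < pi / 2 * (1 - x / \<rho>)" "pi / 2 * (1 - x / \<rho>) < pi / 2 * 2"
    using pi_gt_zero by (intro mult_pos_pos mult_strict_left_mono; simp)+
  then show "0 < angle x" "angle x < 3 * pi / 2" using Arg_v unfolding angle_def by linarith+
qed

text \<open>The directions from north to west lie strictly to the left of \<open>v\<close> for every
  positive slope, so each half-circle runs through all of them.\<close>

lemma abs_offset_less:
  assumes "pi / 2 \<le> \<beta>" "\<beta> \<le> pi"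
  shows "\<bar>offset \<beta>\<bar> < \<rho>"
proof -
  have "0 < 2 * (\<beta> - Arg v) / pi" "2 * (\<beta> - Arg v) / pi < 2"
    using assms Arg_v pi_gt_zero by (simp_all add: field_simps)
  then have "\<bar>1 - 2 * (\<beta> - Arg v) / pi\<bar> < 1" by linarith
  then show ?thesis using rho_pos by (simp add: offset_def abs_mult)
qed

text \<open>The directions west, north-west and north, in the order in which a half-circle meets them.\<close>

definition arc_times :: "nat \<Rightarrow> real list" where
  "arc_times i = map (\<lambda>\<beta>. real i + offset \<beta>) [pi, 3 * pi / 4, pi / 2]"

lemma sorted_arc_times: "sorted_wrt (<) (arc_times i)"
  using pi_gt_zero by (simp add: arc_times_def offset_less_iff)

lemma arc_times_bounds: "t \<in> set (arc_times i) \<Longrightarrow> \<bar>t - real i\<bar> < \<rho>"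
  using abs_offset_less[of pi] abs_offset_less[of "3 * pi / 4"] abs_offset_less[of "pi / 2"] pi_gt_zero
  by (auto simp: arc_times_def)

text \<open>\<open>path_times j\<close> belongs to \<open>k = Suc j\<close>.\<close>

fun path_times :: "nat \<Rightarrow> real list" where
  "path_times 0 = base_list"
| "path_times (Suc j) = path_times j @ arc_times (Suc j) @ map ((+) (real (Suc j))) base_list"

lemma path_times_neq_Nil: "path_times j \<noteq> []"
  by (cases j) (simp_all add: base_list_neq_Nil)

lemma last_path_times: "last (path_times j) = real j + last base_list"
  by (cases j) (simp_all add: base_list_neq_Nil last_map)

lemma set_path_times:
  "set (path_times j) = (\<Union>i\<le>j. (+) (real i) ` base_times) \<union> (\<Union>i\<in>{1..j}. set (arc_times i))"
  by (induction j) (auto simp: atMost_Suc atLeastAtMostSuc_conv)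

lemma base_times_rho: "t \<in> base_times \<Longrightarrow> \<rho> < t \<and> t < 1 - \<rho>"
  using base_bounds[of t] rho_less by linarith

lemma path_times_less: "t \<in> set (path_times j) \<Longrightarrow> t < real (Suc j) - \<rho>"
  using rho_pos rho_less_half
  by (induction j) (auto dest!: base_times_rho arc_times_bounds)

lemma sorted_path_times: "sorted_wrt (<) (path_times j)"
proof (induction j)
  case (Suc j)
  have "sorted_wrt (<) (map ((+) (real (Suc j))) base_list)"
    using sorted_base_list by (simp add: sorted_wrt_map)
  moreover have "x < y" if "x \<in> set (arc_times (Suc j))" "y \<in> (+) (real (Suc j)) ` base_times" for x y
    using that base_times_rho arc_times_bounds by fastforce
  moreover have "x < y" if x: "x \<in> set (path_times j)"
    and y: "y \<in> set (arc_times (Suc j)) \<union> (+) (real (Suc j)) ` base_times" for x y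
  proof -
    have "real (Suc j) - \<rho> < y"
      using y arc_times_bounds base_times_rho rho_pos by fastforce
    then show ?thesis using path_times_less[OF x] by linarith
  qed
  ultimately show ?case
    using Suc sorted_arc_times by (auto simp: sorted_wrt_append)
qed (simp add: sorted_base_list)

lemma path_arc:
  assumes "1 \<le> i" "i < k" "\<bar>t - real i\<bar> < \<rho>"
  shows "deformed_path r k q p t =
    lattice_point (int (i * q)) (int (i * p)) + of_real r * cis (angle (t - real i))"
proof -
  have rd: "round t = int i"
    using assms(3) rho_less_half by (intro round_unique') auto
  have v: "Complex (of_nat q) (of_nat p) = v" by (simp add: complex_eq_iff)
  have lt: "\<bar>t - real i\<bar> * norm v < r"
    using assms(3) v_neq_0 by (simp add: \<rho>_def field_simps)
  have "sgn v = cis (Arg v)" using v_neq_0 by (rule cis_Arg[symmetric])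
  moreover have "(t - real i) * norm v / r = (t - real i) / \<rho>" by (simp add: \<rho>_def)
  ultimately have "deformed_path r k q p t =
      of_nat i * v + of_real r * (cis (Arg v) * cis (pi / 2 * (1 - (t - real i) / \<rho>)))"
    unfolding deformed_path_def Let_def rd v using assms(1,2) lt by (simp add: mult.assoc)
  moreover have "of_nat i * v = lattice_point (int (i * q)) (int (i * p))"
    by (simp add: complex_eq_iff)
  ultimately show ?thesis by (simp add: cis_mult angle_def)
qed

lemma path_line:
  assumes "\<And>i. 1 \<le> i \<Longrightarrow> i < k \<Longrightarrow> \<rho> \<le> \<bar>t - real i\<bar>"
  shows "deformed_path r k q p t = line 0 t"
proof -
  have v: "Complex (of_nat q) (of_nat p) = v" by (simp add: complex_eq_iff)
  have "\<not> (1 \<le> round t \<and> round t < int k \<and> \<bar>t - of_int (round t)\<bar> * norm v < r)"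
  proof
    assume a: "1 \<le> round t \<and> round t < int k \<and> \<bar>t - of_int (round t)\<bar> * norm v < r"
    then obtain i where i: "round t = int i" by (metis nonneg_int_cases zero_less_one less_le_trans less_imp_le)
    then have "\<rho> \<le> \<bar>t - real i\<bar>" using a assms[of i] by auto
    then have "r \<le> \<bar>t - real i\<bar> * norm v" using v_neq_0 by (simp add: \<rho>_def field_simps)
    then show False using a i by simp
  qed
  then show ?thesis
    unfolding deformed_path_def Let_def v line_def by (simp only: if_False add_0)
qed

lemma vector_derivative_path_line:
  assumes "\<And>i. 1 \<le> i \<Longrightarrow> i < k \<Longrightarrow> \<rho> < \<bar>t - real i\<bar>"
  shows "vector_derivative (deformed_path r k q p) (at t) = v"
proof (rule vector_derivative_at)
  let ?S = "\<Inter>i\<in>{1..<k}. {u. \<rho> < \<bar>u - real i\<bar>}"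
  have "(line 0 has_vector_derivative v) (at t)"
    unfolding line_def by (auto intro!: derivative_eq_intros simp: has_vector_derivative_def scaleR_conv_of_real)
  moreover have "open ?S"
    by (intro open_INT) (auto intro!: open_Collect_less continuous_intros)
  moreover have "t \<in> ?S" using assms by auto
  moreover have "line 0 u = deformed_path r k q p u" if "u \<in> ?S" for u
    using that by (intro path_line[symmetric]) (auto intro: less_imp_le)
  ultimately show "(deformed_path r k q p has_vector_derivative v) (at t)"
    by (rule has_vector_derivative_transform_within_open)
qed

lemma vector_derivative_path_arc:
  assumes i: "1 \<le> i" "i < k" "\<bar>t - real i\<bar> < \<rho>"
  shows "vector_derivative (deformed_path r k q p) (at t) =
    of_real (- (pi * r / (2 * \<rho>))) * \<i> * cis (angle (t - real i))"
proof (rule vector_derivative_at)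
  let ?c = "lattice_point (int (i * q)) (int (i * p))"
  have "((\<lambda>u. angle (u - real i)) has_real_derivative - (pi / (2 * \<rho>))) (at t)"
    unfolding angle_def using rho_pos by (auto intro!: derivative_eq_intros simp: field_simps)
  then have "((\<lambda>u. ?c + of_real r * cis (angle (u - real i))) has_vector_derivative
      of_real (- (pi * r / (2 * \<rho>))) * \<i> * cis (angle (t - real i))) (at t)"
  proof -
    assume "((\<lambda>u. angle (u - real i)) has_real_derivative - (pi / (2 * \<rho>))) (at t)"
    then have "((\<lambda>u. angle (u - real i)) has_derivative (*) (- (pi / (2 * \<rho>)))) (at t)"
      unfolding has_field_derivative_def .
    from has_derivative_cis[OF this] have "((\<lambda>u. ?c + of_real r * cis (angle (u - real i))) has_derivative
        (\<lambda>h. of_real r * ((- (pi / (2 * \<rho>)) * h) *\<^sub>R (\<i> * cis (angle (t - real i)))))) (at t)"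
      by (intro has_derivative_eq_rhs[OF has_derivative_add[OF has_derivative_const has_derivative_mult_right]])
        (assumption, simp)
    then show ?thesis
      unfolding has_vector_derivative_def
      by (rule has_derivative_eq_rhs) (simp add: fun_eq_iff scaleR_conv_of_real)
  qed
  moreover have "open {u. \<bar>u - real i\<bar> < \<rho>}"
    by (intro open_Collect_less continuous_intros)
  ultimately show "(deformed_path r k q p has_vector_derivative
      of_real (- (pi * r / (2 * \<rho>))) * \<i> * cis (angle (t - real i))) (at t)"
    by (rule has_vector_derivative_transform_within_open) (use i path_arc in auto)
qed

section \<open>Crossing times of the deformed path\<close>

lemma ex_crosses_translate:
  "(\<exists>A B. crosses (lattice_point a b + z) A B) \<longleftrightarrow> (\<exists>A B. crosses z A B)"
proof
  assume "\<exists>A B. crosses (lattice_point a b + z) A B"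
  then obtain A B where "crosses (lattice_point a b + z) A B" by blast
  moreover have "lattice_point (- a) (- b) + (lattice_point a b + z) = z"
    by (simp add: complex_eq_iff)
  ultimately show "\<exists>A B. crosses z A B"
    by (metis crosses_translate)
qed (use crosses_translate in blast)

lemma base_times_crosses:
  assumes "0 < t" "t < 1"
  shows "(\<exists>A B. crosses (line 0 t) A B) \<longleftrightarrow> t \<in> base_times"
  unfolding ex_crosses_iff base_times_def using base_times_not_both[OF assms] assms
  by (auto simp: algebra_simps)

lemma cos_135: "cos (3 * pi / 4) = - (sqrt 2 / 2)" and sin_135: "sin (3 * pi / 4) = sqrt 2 / 2"
  using cos_add[of "pi / 2" "pi / 4"] sin_add[of "pi / 2" "pi / 4"] by (simp_all add: cos_45 sin_45)

lemma arc_crosses: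
  shows "crosses (of_real r * cis pi) (lattice_point (-1) 0) (lattice_point 0 0)"
    and "crosses (of_real r * cis (3 * pi / 4)) (lattice_point (-1) 1) (lattice_point 0 0)"
    and "crosses (of_real r * cis (pi / 2)) (lattice_point 0 0) (lattice_point 0 1)"
proof -
  show "crosses (of_real r * cis pi) (lattice_point (-1) 0) (lattice_point 0 0)"
    using crosses_horizontal[of "of_real r * cis pi" 0 "-1"] r_pos r_less by simp
  show "crosses (of_real r * cis (pi / 2)) (lattice_point 0 0) (lattice_point 0 1)"
    using crosses_vertical[of "of_real r * cis (pi / 2)" 0 0] r_pos r_less by simp
  have "r * sqrt 2 < 2"
    using r_pos r_less sqrt2_less_2 mult_strict_mono[of r 1 "sqrt 2" 2] by simp
  then show "crosses (of_real r * cis (3 * pi / 4)) (lattice_point (-1) 1) (lattice_point 0 0)"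
    using crosses_diagonal[of "of_real r * cis (3 * pi / 4)" "-1" 1] r_pos
    by (simp add: cos_135 sin_135)
qed

text \<open>On a circle of radius below 1/2 about a lattice point the coordinates and their sum are
  below 1 in size, so an integral one is 0. Up to a factor, each of them is the sine of the
  difference between one of the three directions and the angle; this difference lies strictly
  between -pi and pi, where the sine vanishes only at 0.\<close>

lemma arc_crosses_iff:
  assumes "\<bar>x\<bar> < \<rho>"
  shows "(\<exists>A B. crosses (of_real r * cis (angle x)) A B) \<longleftrightarrow>
           angle x \<in> {pi, 3 * pi / 4, pi / 2}"
proof
  assume "\<exists>A B. crosses (of_real r * cis (angle x)) A B"
  then have a: "r * cos (angle x) \<in> \<int> \<or> r * sin (angle x) \<in> \<int> \<or>
      r * cos (angle x) + r * sin (angle x) \<in> \<int>"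
    unfolding ex_crosses_iff by auto
  let ?\<beta> = "angle x"
  note b = angle_bounds[OF assms]
  have small: "\<bar>r * cos ?\<beta>\<bar> < 1 / 2" "\<bar>r * sin ?\<beta>\<bar> < 1 / 2"
  proof -
    have "\<bar>r * x\<bar> < 1 / 2" if "\<bar>x\<bar> \<le> 1" for x
    proof -
      have "\<bar>r * x\<bar> = r * \<bar>x\<bar>" using r_pos by (simp add: abs_mult)
      also have "\<dots> \<le> r * 1" using that r_pos by (intro mult_left_mono) simp_all
      finally show ?thesis using r_less by simp
    qed
    then show "\<bar>r * cos ?\<beta>\<bar> < 1 / 2" "\<bar>r * sin ?\<beta>\<bar> < 1 / 2" by simp_all
  qed
  have zero: "y = 0" if "y \<in> \<int>" "\<bar>y\<bar> < 1" for y :: real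
    using that by (auto elim!: Ints_cases)
  have "r * cos ?\<beta> = 0 \<or> r * sin ?\<beta> = 0 \<or> r * cos ?\<beta> + r * sin ?\<beta> = 0"
  proof -
    have "\<bar>r * cos ?\<beta> + r * sin ?\<beta>\<bar> < 1" using small by linarith
    then show ?thesis
      using a small zero[of "r * cos ?\<beta>"] zero[of "r * sin ?\<beta>"]
        zero[of "r * cos ?\<beta> + r * sin ?\<beta>"] by auto
  qed
  then consider "cos ?\<beta> = 0" | "sin ?\<beta> = 0" | "cos ?\<beta> + sin ?\<beta> = 0"
  proof -
    assume "r * cos ?\<beta> = 0 \<or> r * sin ?\<beta> = 0 \<or> r * cos ?\<beta> + r * sin ?\<beta> = 0"
    then have "cos ?\<beta> = 0 \<or> sin ?\<beta> = 0 \<or> cos ?\<beta> + sin ?\<beta> = 0"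
      unfolding distrib_left[symmetric] using r_pos by simp
    then show thesis using that by blast
  qed
  then show "?\<beta> \<in> {pi, 3 * pi / 4, pi / 2}"
  proof cases
    case 1
    then have "sin (pi / 2 - ?\<beta>) = 0" by (simp add: sin_diff)
    then have "pi / 2 - ?\<beta> = 0"
      using b pi_gt_zero by (intro sin_eq_0_pi[of "pi / 2 - ?\<beta>"]) (linarith | assumption)+
    then show ?thesis by simp
  next
    case 2
    then have "sin (pi - ?\<beta>) = 0" by (simp only: sin_pi_minus)
    then have "pi - ?\<beta> = 0"
      using b pi_gt_zero by (intro sin_eq_0_pi[of "pi - ?\<beta>"]) (linarith | assumption)+
    then show ?thesis by simp
  next
    case 3
    have "sin (3 * pi / 4 - ?\<beta>) = sqrt 2 / 2 * (cos ?\<beta> + sin ?\<beta>)"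
      unfolding sin_diff cos_135 sin_135 by (simp add: algebra_simps)
    then have "sin (3 * pi / 4 - ?\<beta>) = 0" unfolding 3 by simp
    then have "3 * pi / 4 - ?\<beta> = 0"
      using b pi_gt_zero by (intro sin_eq_0_pi[of "3 * pi / 4 - ?\<beta>"]) (linarith | assumption)+
    then show ?thesis by simp
  qed
next
  assume "angle x \<in> {pi, 3 * pi / 4, pi / 2}"
  then show "\<exists>A B. crosses (of_real r * cis (angle x)) A B"
    using arc_crosses by (metis empty_iff insert_iff)
qed

lemma line_crosses_translate:
  assumes "t \<in> base_times"
  obtains A B where "crosses (line 0 t) A B"
    "crosses (line 0 (real i + t)) (lattice_point (int (i * q)) (int (i * p)) + A)
      (lattice_point (int (i * q)) (int (i * p)) + B)"
proof -
  obtain A B where AB: "crosses (line 0 t) A B"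
    using base_times_crosses[of t] assms by (auto simp: base_times_def)
  from crosses_translate[OF AB, of "int (i * q)" "int (i * p)"] have
    "crosses (line 0 (real i + t)) (lattice_point (int (i * q)) (int (i * p)) + A)
      (lattice_point (int (i * q)) (int (i * p)) + B)"
    using line_add[of 0 t i] by (simp add: add.commute)
  then show thesis using AB that by blast
qed

lemma far_from_integers:
  assumes "t \<in> base_times"
  shows "\<rho> < \<bar>real i + t - real j\<bar>"
proof -
  have "j \<le> i \<or> Suc i \<le> j" by linarith
  then have "real j \<le> real i \<or> real (Suc i) \<le> real j" by (simp only: of_nat_le_iff)
  then show ?thesis using base_times_rho[OF assms] by auto
qed

lemma path_crossing_times:
  "crossing_times (deformed_path r (Suc j) q p) {0<..<real (Suc j)} = path_times j"
proof (rule crossing_times_eq[OF sorted_path_times], intro equalityI subsetI)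
  let ?\<gamma> = "deformed_path r (Suc j) q p"
  fix t assume "t \<in> set (path_times j)"
  then consider i b where "i \<le> j" "b \<in> base_times" "t = real i + b"
    | i where "1 \<le> i" "i \<le> j" "t \<in> set (arc_times i)"
    unfolding set_path_times by auto
  then show "t \<in> {t \<in> {0<..<real (Suc j)}. \<exists>A B. crosses (?\<gamma> t) A B}"
  proof cases
    case 1
    have "?\<gamma> t = line 0 t"
      using far_from_integers[OF 1(2), of i] 1(3) by (intro path_line) (auto intro: less_imp_le)
    moreover have "0 < t" "t < real (Suc j)" using 1 by (auto simp: base_times_def)
    moreover obtain A B where "crosses (line 0 t) A B"
      using line_crosses_translate[OF 1(2), of i] unfolding 1(3) .
    ultimately show ?thesis by auto
  next
    case 2
    have b: "\<bar>t - real i\<bar> < \<rho>" using 2(3) by (rule arc_times_bounds)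
    have "0 < t" "t < real (Suc j)" using b rho_less_half 2(1,2) by auto
    moreover have "angle (t - real i) \<in> {pi, 3 * pi / 4, pi / 2}"
      using 2(3) by (auto simp: arc_times_def)
    then have "\<exists>A B. crosses (?\<gamma> t) A B"
      using path_arc[of i "Suc j" t] 2(1,2) b arc_crosses_iff[OF b] ex_crosses_translate by simp
    ultimately show ?thesis by simp
  qed
next
  let ?\<gamma> = "deformed_path r (Suc j) q p"
  fix t assume "t \<in> {t \<in> {0<..<real (Suc j)}. \<exists>A B. crosses (?\<gamma> t) A B}"
  then have t: "0 < t" "t < real (Suc j)" "\<exists>A B. crosses (?\<gamma> t) A B" by auto
  show "t \<in> set (path_times j)"
  proof (cases "\<exists>i. 1 \<le> i \<and> i < Suc j \<and> \<bar>t - real i\<bar> < \<rho>")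
    case True
    then obtain i where i: "1 \<le> i" "i < Suc j" "\<bar>t - real i\<bar> < \<rho>" by blast
    then have "angle (t - real i) \<in> {pi, 3 * pi / 4, pi / 2}"
      using t(3) path_arc[of i "Suc j" t] arc_crosses_iff[OF i(3)] ex_crosses_translate by simp
    then have "t - real i \<in> offset ` {pi, 3 * pi / 4, pi / 2}"
      by (metis image_eqI offset_angle)
    then have "t \<in> set (arc_times i)"
      by (auto simp: arc_times_def algebra_simps)
    then show ?thesis unfolding set_path_times using i by auto
  next
    case False
    then have line: "?\<gamma> t = line 0 t" by (intro path_line) force
    \<comment> \<open>Off the half-circles the time is reduced modulo 1. The remainder 0 would put
      the line at a lattice point, which is no crossing.\<close>
    define i where "i = nat \<lfloor>t\<rfloor>"
    define b where "b = t - real i"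
    have i: "real i \<le> t" "t < real i + 1" using t(1) by (auto simp: i_def of_nat_floor)
    then have b: "0 \<le> b" "b < 1" "t = b + real i" by (auto simp: b_def)
    have "\<exists>A B. crosses (line 0 (b + real i)) A B"
      using t(3) line b(3) by simp
    then have "\<exists>A B. crosses (line 0 b) A B"
      unfolding line_add ex_crosses_translate .
    moreover from this have "b \<noteq> 0" unfolding ex_crosses_iff by auto
    ultimately have "b \<in> base_times" using base_times_crosses[of b] b by auto
    moreover have "i \<le> j" using i(1) t(2) by linarith
    ultimately show ?thesis unfolding set_path_times using b(3) by (auto simp: add.commute)
  qed
qed

section \<open>Signs of the deformed path\<close>

lemma ends_at_line_translate:
  assumes "t \<in> base_times"
  shows "ends_at (deformed_path r k q p) (real i + t) =
    (+) (lattice_point (int (i * q)) (int (i * p))) ` ends_at (line 0) t"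
    and "height v (deformed_path r k q p (real i + t)) = 0"
    and "vector_derivative (deformed_path r k q p) (at (real i + t)) = v"
    and "\<exists>A B. crosses (deformed_path r k q p (real i + t)) A B"
proof -
  let ?\<gamma> = "deformed_path r k q p"
  have \<gamma>: "?\<gamma> (real i + t) = line 0 (real i + t)"
    using far_from_integers[OF assms] by (intro path_line) (auto intro: less_imp_le)
  then show "height v (?\<gamma> (real i + t)) = 0" by simp
  show "vector_derivative ?\<gamma> (at (real i + t)) = v"
    using far_from_integers[OF assms] by (intro vector_derivative_path_line)
  obtain A B where "crosses (line 0 t) A B"
    "crosses (?\<gamma> (real i + t)) (lattice_point (int (i * q)) (int (i * p)) + A)
      (lattice_point (int (i * q)) (int (i * p)) + B)"
    using line_crosses_translate[OF assms, of i] unfolding \<gamma> .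
  then show "ends_at ?\<gamma> (real i + t) = (+) (lattice_point (int (i * q)) (int (i * p))) ` ends_at (line 0) t"
    and "\<exists>A B. crosses (?\<gamma> (real i + t)) A B"
    using ends_at_eq[of ?\<gamma> "real i + t"] ends_at_eq[of "line 0" t] by auto
qed

lemma inner_signs_base: "inner_signs s (deformed_path r k q p) (map ((+) (real i)) base_list) = base_signs s"
proof -
  let ?\<gamma> = "deformed_path r k q p"
  have "inner_signs s ?\<gamma> (map ((+) (real i)) base_list) =
      edge_signs s v 0 (map (ends_at ?\<gamma>) (map ((+) (real i)) base_list))"
  proof (rule inner_signs_straight)
    fix t assume "t \<in> set (map ((+) (real i)) base_list)"
    then obtain b where b: "b \<in> base_times" "t = real i + b" by auto
    show "vector_derivative ?\<gamma> (at t) = v \<and> height v (?\<gamma> t) = 0 \<and>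
        (\<exists>A B. crosses (?\<gamma> t) A B \<and> height v A \<noteq> height v B)"
      using ends_at_line_translate(2-4)[OF b(1), of k i] crosses_height(1) unfolding b(2) by blast
  qed
  also have "map (ends_at ?\<gamma>) (map ((+) (real i)) base_list) =
      map ((`) ((+) (lattice_point (int (i * q)) (int (i * p))))) base_edges"
    by (simp add: base_edges_def ends_at_line_translate(1))
  finally show ?thesis
    by (simp add: edge_signs_translate height_lattice_point base_signs_def)
qed

text \<open>The points tested lie on the ray from the centre through the current position, and the
  clockwise tangent is perpendicular to it, so the side is the sign of l - r. The bound 1/2 on the
  radius makes the centre the closer endpoint.\<close>

lemma arc_sides:
  assumes i: "1 \<le> i" "i < k" "\<bar>t - real i\<bar> < \<rho>"
  defines "c \<equiv> lattice_point (int (i * q)) (int (i * p))"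
  shows "right_of (deformed_path r k q p) t c"
    and "1 \<le> l \<Longrightarrow> left_of (deformed_path r k q p) t (c + of_real l * cis (angle (t - real i)))"
    and "1 \<le> l \<Longrightarrow> dist (deformed_path r k q p t) c <
           dist (deformed_path r k q p t) (c + of_real l * cis (angle (t - real i)))"
proof -
  let ?\<gamma> = "deformed_path r k q p" and ?u = "cis (angle (t - real i))"
  have \<gamma>: "?\<gamma> t = c + of_real r * ?u" using path_arc[OF i] by (simp add: c_def)
  have K: "pi * r / (2 * \<rho>) > 0" using r_pos rho_pos by simp
  have side: "Im (cnj (vector_derivative ?\<gamma> (at t)) * (c + of_real l * ?u - ?\<gamma> t)) =
      pi * r / (2 * \<rho>) * (l - r)" for l
  proof -
    have "cnj ?u * ?u = 1" by (simp add: cis_cnj cis_mult)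
    then have "cnj (vector_derivative ?\<gamma> (at t)) * (c + of_real l * ?u - ?\<gamma> t) =
        of_real (pi * r / (2 * \<rho>) * (l - r)) * \<i>"
      unfolding vector_derivative_path_arc[OF i] \<gamma>
      by (simp add: algebra_simps)
    then show ?thesis by simp
  qed
  have side0: "Im (cnj (vector_derivative ?\<gamma> (at t)) * (c - ?\<gamma> t)) = pi * r / (2 * \<rho>) * (0 - r)"
    using side[of 0] by (simp only: of_real_0 mult_zero_left add_0_right)
  show "right_of ?\<gamma> t c"
    unfolding right_of_def side0 using K r_pos by (intro mult_pos_neg) simp_all
  show "1 \<le> l \<Longrightarrow> left_of ?\<gamma> t (c + of_real l * ?u)"
    unfolding left_of_def side using K r_less by (intro mult_pos_pos) simp_all
  show "dist (?\<gamma> t) c < dist (?\<gamma> t) (c + of_real l * ?u)" if "1 \<le> l"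
  proof -
    have "?\<gamma> t - (c + of_real l * ?u) = of_real (r - l) * ?u" unfolding \<gamma> by (simp add: algebra_simps)
    then have "dist (?\<gamma> t) (c + of_real l * ?u) = \<bar>r - l\<bar>"
      by (simp add: dist_norm norm_mult del: of_real_diff)
    moreover have "dist (?\<gamma> t) c = r" unfolding \<gamma> using r_pos by (simp add: dist_norm norm_mult)
    ultimately show ?thesis using that r_less by simp
  qed
qed

text \<open>The endpoints enter as a set, because the segments to the west and north-west have the
  lattice point as their second endpoint.\<close>

lemma arc_crossing:
  assumes i: "1 \<le> i" "i < k" and AB: "\<beta> \<in> {pi / 2..pi}" "1 \<le> l"
    and c: "crosses (of_real r * cis \<beta>) A B" "{A, B} = {0, of_real l * cis \<beta>}"
  defines "c \<equiv> lattice_point (int (i * q)) (int (i * p))" and "t \<equiv> real i + offset \<beta>"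
  shows "ends_at (deformed_path r k q p) t = {c, c + of_real l * cis \<beta>}"
    and "crossing_sign s (deformed_path r k q p) t = Minus"
    and "right_of (deformed_path r k q p) t c"
    and "left_of (deformed_path r k q p) t (c + of_real l * cis \<beta>)"
proof -
  let ?\<gamma> = "deformed_path r k q p"
  have near: "\<bar>t - real i\<bar> < \<rho>" using abs_offset_less AB(1) by (simp add: t_def)
  have \<beta>: "angle (t - real i) = \<beta>" by (simp add: t_def)
  have "crosses (?\<gamma> t) (c + A) (c + B)"
    unfolding path_arc[OF i near] \<beta> c_def by (rule crosses_translate[OF c(1)])
  then have "ends_at ?\<gamma> t = (+) c ` {A, B}" using ends_at_eq[of ?\<gamma> t] by simp
  then show ends: "ends_at ?\<gamma> t = {c, c + of_real l * cis \<beta>}" unfolding c(2) by simp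
  note sides = arc_sides[OF i near, unfolded \<beta>, folded c_def]
  show right: "right_of ?\<gamma> t c" by (rule sides(1))
  show left: "left_of ?\<gamma> t (c + of_real l * cis \<beta>)" by (rule sides(2)[OF AB(2)])
  show "crossing_sign s ?\<gamma> t = Minus"
    by (subst crossing_sign_between[OF _ left right]) (use ends sides(3)[OF AB(2)] in auto)
qed

lemma inner_signs_path:
  "j < k \<Longrightarrow> inner_signs s (deformed_path r k q p) (path_times j) =
     base_signs s @ concat (replicate j (turn_signs Plus @ base_signs s))"
proof (induction j)
  case 0
  have "map ((+) (real 0)) base_list = base_list" by (simp add: map_idI)
  then show ?case using inner_signs_base[of s k 0] by simp
next
  case (Suc j)
  let ?\<gamma> = "deformed_path r k q p" and ?i = "Suc j"
  let ?c = "lattice_point (int (?i * q)) (int (?i * p))"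
  let ?next = "map ((+) (real ?i)) base_list"
  have i: "1 \<le> ?i" "?i < k" using Suc.prems by auto
  have W: "of_real 1 * cis pi = lattice_point (-1) 0" "of_real 1 * cis (pi / 2) = lattice_point 0 1"
    "of_real (sqrt 2) * cis (3 * pi / 4) = lattice_point (-1) 1"
    by (simp_all add: complex_eq_iff cos_135 sin_135)
  have zero: "lattice_point 0 0 = 0" by (simp add: complex_eq_iff)
  have sqrt: "1 \<le> sqrt 2" by simp
  note west = arc_crossing[OF i, where \<beta> = pi and l = 1, OF _ order_refl arc_crosses(1), unfolded W zero]
  note north = arc_crossing[OF i, where \<beta> = "pi / 2" and l = 1, OF _ order_refl arc_crosses(3), unfolded W zero]
  note north_west = arc_crossing[OF i, where \<beta> = "3 * pi / 4" and l = "sqrt 2", OF _ sqrt arc_crosses(2), unfolded W zero]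
  let ?W = "real ?i + offset pi" and ?N = "real ?i + offset (pi / 2)"
    and ?NW = "real ?i + offset (3 * pi / 4)"
  have pi: "pi \<in> {pi / 2..pi}" "pi / 2 \<in> {pi / 2..pi}" "3 * pi / 4 \<in> {pi / 2..pi}"
    using pi_gt_zero by auto
  have west: "ends_at ?\<gamma> ?W = {?c, ?c + lattice_point (-1) 0}" "crossing_sign s ?\<gamma> ?W = Minus"
    "right_of ?\<gamma> ?W ?c"
    using west[OF pi(1)] by (auto simp: insert_commute)
  have north: "ends_at ?\<gamma> ?N = {?c, ?c + lattice_point 0 1}" "crossing_sign s ?\<gamma> ?N = Minus"
    "right_of ?\<gamma> ?N ?c" "left_of ?\<gamma> ?N (?c + lattice_point 0 1)"
    using north[OF pi(2)] by (auto simp: insert_commute)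
  have north_west: "ends_at ?\<gamma> ?NW = {?c, ?c + lattice_point (-1) 1}"
    "crossing_sign s ?\<gamma> ?NW = Minus" "right_of ?\<gamma> ?NW ?c"
    using north_west[OF pi(3)] by (auto simp: insert_commute)
  have c1: "corner_sign ?\<gamma> ?W ?NW = Minus"
    unfolding corner_sign_def west(1) north_west(1) using west(3) by auto
  have c2: "corner_sign ?\<gamma> ?NW ?N = Minus"
    unfolding corner_sign_def north(1) north_west(1) using north_west(3) by auto
  \<comment> \<open>This corner is decided on the straight part, with tangent \<open>v\<close>; the
    common endpoint is the western neighbour of \<open>?c\<close>, at height p.\<close>
  have "corner_sign ?\<gamma> (last (path_times j)) ?W =
      edge_corner_sign v 0 {lattice_point (int (?i * q) - 1) (int (?i * p)),
         lattice_point (int (?i * q)) (int (?i * p) - 1)} {?c, ?c + lattice_point (-1) 0}"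
  proof -
    have l: "last base_list \<in> base_times" using base_list_neq_Nil last_in_set set_base_list by blast
    have "ends_at (line 0) (last base_list) = last base_edges"
      by (simp add: base_edges_def last_map base_list_neq_Nil)
    then have "ends_at ?\<gamma> (real j + last base_list) =
        {lattice_point (int (?i * q) - 1) (int (?i * p)), lattice_point (int (?i * q)) (int (?i * p) - 1)}"
      unfolding ends_at_line_translate(1)[OF l] by (simp add: last_base_edges lattice_point_add algebra_simps)
    then show ?thesis
      unfolding last_path_times corner_sign_straight[OF ends_at_line_translate(3)[OF l]] west(1)
        ends_at_line_translate(2)[OF l] by simp
  qed
  also have "\<dots> = Plus"
    using p_pos by (simp add: edge_corner_sign_def lattice_point_add height_lattice_point algebra_simps)
  finally have c0: "corner_sign ?\<gamma> (last (path_times j)) ?W = Plus" .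
  \<comment> \<open>This corner is decided at the last crossing of the half-circle, so by the
    tangent there and not by \<open>v\<close>.\<close>
  have c3: "corner_sign ?\<gamma> ?N (hd ?next) = Plus"
  proof -
    have h: "hd base_list \<in> base_times" using base_list_neq_Nil hd_in_set set_base_list by blast
    have "ends_at (line 0) (hd base_list) = hd base_edges"
      by (simp add: base_edges_def hd_map base_list_neq_Nil)
    then have "ends_at ?\<gamma> (hd ?next) = {?c + lattice_point 0 1, ?c + lattice_point 1 0}"
      by (simp add: hd_map base_list_neq_Nil ends_at_line_translate(1)[OF h, of k ?i, simplified] hd_base_edges)
    then have "ends_at ?\<gamma> ?N \<inter> ends_at ?\<gamma> (hd ?next) = {?c + lattice_point 0 1}"
      unfolding north(1) by (auto simp: lattice_point_add)
    moreover have "\<not> right_of ?\<gamma> ?N (?c + lattice_point 0 1)"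
      using north(4) by (auto simp: left_of_def right_of_def)
    ultimately show ?thesis by (simp add: corner_sign_def)
  qed
  have "inner_signs s ?\<gamma> (?N # ?next) = Minus # Plus # base_signs s"
    using inner_signs_append[of "[?N]" ?next s ?\<gamma>] base_list_neq_Nil c3 north(2)
      inner_signs_base[of s k ?i] by simp
  then have "inner_signs s ?\<gamma> (path_times (Suc j)) = inner_signs s ?\<gamma> (path_times j) @ Plus #
      [Minus, Minus, Minus, Minus, Minus] @ Plus # base_signs s"
    using path_times_neq_Nil c0 c1 c2 west(2) north_west(2)
    by (simp add: inner_signs_append arc_times_def del: of_nat_Suc)
  moreover have "concat (replicate j X @ [X]) = concat (X # replicate j X)" for X :: "pm list"
    by (simp only: replicate_append_same)
  ultimately show ?case
    using Suc by (simp add: turn_signs_def numeral_eq_Suc)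
qed

section \<open>Both numbers from the matrix of one period\<close>

definition period_matrix :: "int^2^2" where
  "period_matrix = word_matrix (base_signs Plus @ turn_signs Plus)"

text \<open>There is one turn fewer than there are straight parts; writing (1, 1) as the image of
  (1, -1) supplies the missing one after the last part.\<close>

lemma word_matrix_path:
  "word_matrix (base_signs Plus @ concat (replicate j (turn_signs Plus @ base_signs Plus))) *v vector [1, 1] =
     ((*v) period_matrix ^^ Suc j) (vector [1, -1])"
proof (induction j)
  case 0
  then show ?case
    by (simp add: period_matrix_def word_matrix_append word_matrix_turn_signs
        flip: matrix_vector_mul_assoc)
next
  case (Suc j)
  have "base_signs Plus @ concat (replicate (Suc j) (turn_signs Plus @ base_signs Plus)) =
      (base_signs Plus @ turn_signs Plus) @
        (base_signs Plus @ concat (replicate j (turn_signs Plus @ base_signs Plus)))"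
    by simp
  then show ?case
    by (simp only: word_matrix_append[of "base_signs Plus @ turn_signs Plus"] period_matrix_def[symmetric]
        matrix_vector_mul_assoc[symmetric] Suc funpow.simps o_apply)
qed

lemma markov_num_eq:
  "markov_num s r k q p =
     (\<Sum>i\<in>UNIV. ((*v) period_matrix ^^ k) (vector [1, -1]) $ i)"
proof (cases k)
  case 0
  then show ?thesis by (simp add: markov_num_def sum_2)
next
  case (Suc j)
  define s' where "s' = (if k = 1 then s else Plus)"
  define W where "W = (\<lambda>f. word_matrix (base_signs f @ concat (replicate j (turn_signs Plus @ base_signs f))))"
  have "markov_num s r k q p = cf_numerator (block_lengths
      (Minus # (base_signs s' @ concat (replicate j (turn_signs Plus @ base_signs s'))) @ [Plus]))"
    unfolding markov_num_def sign_sequence_def Suc path_crossing_times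
    by (subst inner_signs_path) (simp_all add: s'_def Suc)
  also have "\<dots> = (\<Sum>i\<in>UNIV. \<Sum>j\<in>UNIV. W s' $ i $ j)"
    unfolding W_def by (rule cf_numerator_eq)
  also have "\<dots> = (\<Sum>i\<in>UNIV. \<Sum>j\<in>UNIV. W Plus $ i $ j)"
  proof (cases s')
    \<comment> \<open>\<open>Minus\<close> is possible only for k = 1. Then the word has no turns
      and is reversed and flipped as a whole.\<close>
    case Minus
    then have j: "j = 0" using Suc by (auto simp: s'_def split: if_splits)
    have "W Minus = transpose (W Plus)"
      using base_signs_flip[of Plus] by (simp add: W_def j transpose_word_matrix)
    then show ?thesis unfolding Minus by (simp add: sum_2 transpose_def)
  qed simp
  also have "\<dots> = (\<Sum>i\<in>UNIV. (W Plus *v vector [1, 1]) $ i)"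
    by (simp add: matrix_vector_mult_def sum_2)
  also have "W Plus *v vector [1, 1] = ((*v) period_matrix ^^ k) (vector [1, -1])"
    unfolding W_def word_matrix_path Suc ..
  finally show ?thesis .
qed

text \<open>Changing the side reverses and flips the word up to a rotation; transposition and
  rotation both preserve the trace.\<close>

lemma trace_period_matrix:
  "trace (word_matrix (base_signs s @ turn_signs s)) = trace period_matrix"
proof (cases s)
  case Minus
  have tr: "trace (transpose A) = trace A" for A :: "int^2^2"
    by (simp add: trace_def transpose_def)
  have "word_matrix (base_signs Minus @ turn_signs Minus) =
      transpose (word_matrix (turn_signs Plus) ** word_matrix (base_signs Plus))"
    using base_signs_flip[of Plus] turn_signs_flip[of Plus]
    by (simp add: word_matrix_append matrix_transpose_mul transpose_word_matrix)
  then have "trace (word_matrix (base_signs Minus @ turn_signs Minus)) =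
      trace (word_matrix (turn_signs Plus) ** word_matrix (base_signs Plus))"
    by (simp only: tr)
  also have "\<dots> = trace period_matrix"
    unfolding period_matrix_def word_matrix_append by (rule trace_mul_sym)
  finally show ?thesis unfolding Minus .
qed (simp add: period_matrix_def)

lemma markov_circ_eq:
  assumes "small_nudge q p \<epsilon> \<eta>"
  shows "int (markov_circ q p \<epsilon> \<eta>) = trace period_matrix"
proof -
  define z where "z = nudged_start q p \<epsilon> \<eta>"
  have curve: "closed_curve q p \<epsilon> \<eta> = line z"
    by (rule ext) (simp add: closed_curve_def line_def z_def complex_eq_iff)
  have z: "0 < Re z" "0 < Im z" "Re z + Im z < 1"
    and h: "height v z \<noteq> 0" "\<bar>height v z\<bar> < 1 / 2"
    using assms by (simp_all add: small_nudge_def Let_def z_def[symmetric] height_v)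
  obtain s where "cyclic_signs (line z) = base_signs s @ turn_signs s"
    using cyclic_signs_line[OF z h] by simp
  then have "int (markov_circ q p \<epsilon> \<eta>) = trace (word_matrix (base_signs s @ turn_signs s))"
    unfolding markov_circ_def curve by (simp only:) (rule card_good_matchings, simp add: turn_signs_def)
  then show ?thesis unfolding trace_period_matrix .
qed

end

theorem theorem5p6:
  fixes p q k :: nat and r \<epsilon> \<eta> :: real and s :: pm
  assumes "0 < p" and "p \<le> q" and "coprime p q" and "2 \<le> k"
    and "0 < r" and "r < 1 / 2"
    and "small_nudge q p \<epsilon> \<eta>"
  shows "markov_num s r k q p =
           int (markov_circ q p \<epsilon> \<eta>) * markov_num s r (k - 1) q p - markov_num s r (k - 2) q p"
proof -
  interpret deformation q p r
    using assms by unfold_locales auto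
  \<comment> \<open>For k = 2 this is (1, -1), whose coordinates add up to 0, the value for (0,
    0).\<close>
  define y where "y = ((*v) period_matrix ^^ (k - 2)) (vector [1, -1])"
  have k: "k - 1 = Suc (k - 2)" "k = Suc (Suc (k - 2))" using assms(4) by auto
  have "((*v) period_matrix ^^ k) (vector [1, -1]) = period_matrix *v (period_matrix *v y)"
    by (subst k(2)) (simp add: y_def)
  also have "\<dots> = trace period_matrix *s (period_matrix *v y) - y"
    unfolding cayley_hamilton_2 by (simp add: period_matrix_def det_word_matrix)
  finally show ?thesis
    unfolding markov_num_eq markov_circ_eq[OF assms(7)] k(1)
    by (simp only: sum_2 vector_minus_component vector_smult_component funpow.simps o_apply
        y_def[symmetric] distrib_left diff_add_eq add_diff_eq diff_diff_eq add.commute add.left_commute)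
qed

end
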